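(* Let $\vec X=(X_0,X_1)$ and $\vec Y=(Y_0,Y_1)$ be couples of regular Banach lattices with the Fatou property and let $T:X_0+X_1\to Y_0+Y_1$ be a positive operator which is bounded $X_j\to Y_j$, $j=0,1$. If $T:X_0^{1-\theta_*}X_1^{\theta_*}\to Y_0^{1-\theta_*}Y_1^{\theta_*}$ is an order isomorphism for some $\theta_*\in(0,1)$, then $$T:X_0^{1-\theta}X_1^\theta\to Y_0^{1-\theta}Y_1^\theta\quad\text{and}\quad T:(X_0,X_1)_{\theta,p}\to(Y_0,Y_1)_{\theta,p}$$ are order isomorphisms for all $\theta\in(0,1)$ and all $p\in[1,\infty]$.
   Context: A Banach lattice on a $\sigma$-finite measure space $(\Omega,\Sigma,\mu)$ is a Banach space $X\subset L^0(\mu)$ containing a $\mu$-a.e. strictly positive element and solid: if $f\in L^0(\mu)$, $g\in X$, $|f|\le|g|$ a.e., then $f\in X$ and $\|f\|_X\le\|g\|_X$. Fatou property: if $0\le f_n\uparrow f$ a.e. with $f_n\in X$ and $\sup_n\|f_n\|_X<\infty$, then $f\in X$ and $\|f_n\|_X\uparrow\|f\|_X$. A Banach lattice is regular if its norm is order continuous (absolutely continuous); for couples of regular lattices $X_0\cap X_1$ is dense in each Calderón product $X_0^{1-\alpha}X_1^\alpha$, $\alpha\in(0,1)$. The Calderón product $X_0^{1-\theta}X_1^\theta$ consists of $f\in L^0(\mu)$ with $|f|\le\lambda|f_0|^{1-\theta}|f_1|^\theta$ a.e. for some $\lambda>0$ and $\|f_j\|_{X_j}\le1$, normed by the infimum of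 such $\lambda$. $(X_0,X_1)_{\theta,p}$ is the real interpolation space with norm $\big(\int_0^\infty(t^{-\theta}K(t,x;\vec X))^p\,dt/t\big)^{1/p}$ (sup for $p=\infty$), $K(t,x;\vec X)=\inf\{\|x_0\|_{X_0}+t\|x_1\|_{X_1}:x=x_0+x_1\}$; it is again a Banach lattice. $T$ is positive if $Tf\ge0$ whenever $f\ge0$. An order isomorphism is a linear bijection $T$ with $T$ and $T^{-1}$ both positive. *)

theory Defs
  imports "HOL-Analysis.Analysis"
begin

text \<open>A Banach lattice on a sigma-finite measure space M is given by a function norm
  rho on L0(M) (measurable real functions, identified a.e.); the lattice itself is the
  set of measurable f with rho f finite.\<close>

definition lat :: "'a measure \<Rightarrow> (('a \<Rightarrow> real) \<Rightarrow> ennreal) \<Rightarrow> ('a \<Rightarrow> real) set" where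
  "lat M \<rho> = {f \<in> borel_measurable M. \<rho> f < \<infinity>}"

definition banach_lattice :: "'a measure \<Rightarrow> (('a \<Rightarrow> real) \<Rightarrow> ennreal) \<Rightarrow> bool" where
  "banach_lattice M \<rho> \<longleftrightarrow>
     sigma_finite_measure M \<and>
     \<comment> \<open>norm axioms on the space\<close>
     (\<forall>f \<in> borel_measurable M. \<rho> f = 0 \<longleftrightarrow> (AE x in M. f x = 0)) \<and>
     (\<forall>f \<in> borel_measurable M. \<forall>c. \<rho> (\<lambda>x. c * f x) = ennreal \<bar>c\<bar> * \<rho> f) \<and>
     (\<forall>f \<in> borel_measurable M. \<forall>g \<in> borel_measurable M. \<rho> (\<lambda>x. f x + g x) \<le> \<rho> f + \<rho> g) \<and>
     \<comment> \<open>solidity\<close>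
     (\<forall>f \<in> borel_measurable M. \<forall>g \<in> lat M \<rho>.
        (AE x in M. \<bar>f x\<bar> \<le> \<bar>g x\<bar>) \<longrightarrow> f \<in> lat M \<rho> \<and> \<rho> f \<le> \<rho> g) \<and>
     \<comment> \<open>a.e. strictly positive element\<close>
     (\<exists>g \<in> lat M \<rho>. AE x in M. 0 < g x) \<and>
     \<comment> \<open>completeness (Banach space)\<close>
     (\<forall>s :: nat \<Rightarrow> 'a \<Rightarrow> real. (\<forall>n. s n \<in> lat M \<rho>) \<and>
        (\<forall>e>0. \<exists>N. \<forall>m\<ge>N. \<forall>n\<ge>N. \<rho> (\<lambda>x. s m x - s n x) < ennreal e) \<longrightarrow>
        (\<exists>f \<in> lat M \<rho>. (\<lambda>n. \<rho> (\<lambda>x. s n x - f x)) \<longlonglongrightarrow> 0))"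

definition fatou :: "'a measure \<Rightarrow> (('a \<Rightarrow> real) \<Rightarrow> ennreal) \<Rightarrow> bool" where
  "fatou M \<rho> \<longleftrightarrow>
     (\<forall>(fs :: nat \<Rightarrow> 'a \<Rightarrow> real) f. (\<forall>n. fs n \<in> lat M \<rho>) \<and> f \<in> borel_measurable M \<and>
        (AE x in M. 0 \<le> fs 0 x \<and> incseq (\<lambda>n. fs n x) \<and> (\<lambda>n. fs n x) \<longlonglongrightarrow> f x) \<and>
        (SUP n. \<rho> (fs n)) < \<infinity> \<longrightarrow>
        f \<in> lat M \<rho> \<and> (\<lambda>n. \<rho> (fs n)) \<longlonglongrightarrow> \<rho> f)"

text \<open>Regular = order continuous norm (sequential form: 0 <= f_n decreasing to 0 a.e.
  implies norms tend to 0).\<close>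
definition regular :: "'a measure \<Rightarrow> (('a \<Rightarrow> real) \<Rightarrow> ennreal) \<Rightarrow> bool" where
  "regular M \<rho> \<longleftrightarrow>
     (\<forall>fs :: nat \<Rightarrow> 'a \<Rightarrow> real. (\<forall>n. fs n \<in> lat M \<rho>) \<and>
        (AE x in M. (\<forall>n. 0 \<le> fs n x) \<and> decseq (\<lambda>n. fs n x) \<and> (\<lambda>n. fs n x) \<longlonglongrightarrow> 0) \<longrightarrow>
        (\<lambda>n. \<rho> (fs n)) \<longlonglongrightarrow> 0)"

definition sum_space :: "'a measure \<Rightarrow> (('a \<Rightarrow> real) \<Rightarrow> ennreal) \<Rightarrow> (('a \<Rightarrow> real) \<Rightarrow> ennreal)
    \<Rightarrow> ('a \<Rightarrow> real) set" where
  "sum_space M \<rho>0 \<rho>1 = {f \<in> borel_measurable M. \<exists>f0 \<in> lat M \<rho>0. \<exists>f1 \<in> lat M \<rho>1.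
      AE x in M. f x = f0 x + f1 x}"

definition calderon_norm :: "'a measure \<Rightarrow> (('a \<Rightarrow> real) \<Rightarrow> ennreal) \<Rightarrow> (('a \<Rightarrow> real) \<Rightarrow> ennreal)
    \<Rightarrow> real \<Rightarrow> ('a \<Rightarrow> real) \<Rightarrow> ennreal" where
  "calderon_norm M \<rho>0 \<rho>1 \<theta> f = (INF l \<in> {l::real. l > 0 \<and> (\<exists>f0 \<in> borel_measurable M. \<exists>f1 \<in> borel_measurable M.
        \<rho>0 f0 \<le> 1 \<and> \<rho>1 f1 \<le> 1 \<and>
        (AE x in M. \<bar>f x\<bar> \<le> l * (\<bar>f0 x\<bar> powr (1 - \<theta>) * \<bar>f1 x\<bar> powr \<theta>)))}. ennreal l)"

definition calderon :: "'a measure \<Rightarrow> (('a \<Rightarrow> real) \<Rightarrow> ennreal) \<Rightarrow> (('a \<Rightarrow> real) \<Rightarrow> ennreal)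
    \<Rightarrow> real \<Rightarrow> ('a \<Rightarrow> real) set" where
  "calderon M \<rho>0 \<rho>1 \<theta> = lat M (calderon_norm M \<rho>0 \<rho>1 \<theta>)"

definition Kfun :: "'a measure \<Rightarrow> (('a \<Rightarrow> real) \<Rightarrow> ennreal) \<Rightarrow> (('a \<Rightarrow> real) \<Rightarrow> ennreal)
    \<Rightarrow> real \<Rightarrow> ('a \<Rightarrow> real) \<Rightarrow> ennreal" where
  "Kfun M \<rho>0 \<rho>1 t f = (INF p \<in> {(f0, f1). f0 \<in> borel_measurable M \<and> f1 \<in> borel_measurable M \<and>
        (AE x in M. f x = f0 x + f1 x)}. \<rho>0 (fst p) + ennreal t * \<rho>1 (snd p))"

definition epow :: "ennreal \<Rightarrow> real \<Rightarrow> ennreal" where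
  "epow x q = (if x = \<infinity> then \<infinity> else ennreal (enn2real x powr q))"

definition real_interp_norm :: "'a measure \<Rightarrow> (('a \<Rightarrow> real) \<Rightarrow> ennreal) \<Rightarrow> (('a \<Rightarrow> real) \<Rightarrow> ennreal)
    \<Rightarrow> real \<Rightarrow> ennreal \<Rightarrow> ('a \<Rightarrow> real) \<Rightarrow> ennreal" where
  "real_interp_norm M \<rho>0 \<rho>1 \<theta> p f =
     (if p = \<infinity> then (SUP t \<in> {0<..}. ennreal (t powr (- \<theta>)) * Kfun M \<rho>0 \<rho>1 t f)
      else epow (\<integral>\<^sup>+ t \<in> {0<..}. epow (ennreal (t powr (- \<theta>)) * Kfun M \<rho>0 \<rho>1 t f) (enn2real p)
                    * ennreal (1 / t) \<partial>lborel) (1 / enn2real p))"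

definition real_interp :: "'a measure \<Rightarrow> (('a \<Rightarrow> real) \<Rightarrow> ennreal) \<Rightarrow> (('a \<Rightarrow> real) \<Rightarrow> ennreal)
    \<Rightarrow> real \<Rightarrow> ennreal \<Rightarrow> ('a \<Rightarrow> real) set" where
  "real_interp M \<rho>0 \<rho>1 \<theta> p = lat M (real_interp_norm M \<rho>0 \<rho>1 \<theta> p)"

definition order_iso :: "'a measure \<Rightarrow> 'b measure \<Rightarrow> (('a \<Rightarrow> real) \<Rightarrow> ('b \<Rightarrow> real))
    \<Rightarrow> ('a \<Rightarrow> real) set \<Rightarrow> ('b \<Rightarrow> real) set \<Rightarrow> bool" where
  "order_iso M N T A B \<longleftrightarrow>
     (\<forall>f \<in> A. T f \<in> B) \<and>
     (\<forall>f \<in> A. \<forall>g \<in> A. \<forall>a b. AE y in N. T (\<lambda>x. a * f x + b * g x) y = a * T f y + b * T g y) \<and>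
     (\<forall>f \<in> A. \<forall>g \<in> A. (AE y in N. T f y = T g y) \<longrightarrow> (AE x in M. f x = g x)) \<and>
     (\<forall>g \<in> B. \<exists>f \<in> A. AE y in N. T f y = g y) \<and>
     (\<forall>f \<in> A. (AE x in M. 0 \<le> f x) \<longrightarrow> (AE y in N. 0 \<le> T f y)) \<and>
     (\<forall>f \<in> A. (AE y in N. 0 \<le> T f y) \<longrightarrow> (AE x in M. 0 \<le> f x))"

definition admissible_positive_op ::
  "'a measure \<Rightarrow> (('a \<Rightarrow> real) \<Rightarrow> ennreal) \<Rightarrow> (('a \<Rightarrow> real) \<Rightarrow> ennreal) \<Rightarrow>
   'b measure \<Rightarrow> (('b \<Rightarrow> real) \<Rightarrow> ennreal) \<Rightarrow> (('b \<Rightarrow> real) \<Rightarrow> ennreal) \<Rightarrow>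
   (('a \<Rightarrow> real) \<Rightarrow> ('b \<Rightarrow> real)) \<Rightarrow> bool" where
  "admissible_positive_op M \<rho>0 \<rho>1 N \<sigma>0 \<sigma>1 T \<longleftrightarrow>
     (\<forall>f \<in> sum_space M \<rho>0 \<rho>1. T f \<in> sum_space N \<sigma>0 \<sigma>1) \<and>
     (\<forall>f \<in> sum_space M \<rho>0 \<rho>1. \<forall>g \<in> sum_space M \<rho>0 \<rho>1.
        (AE x in M. f x = g x) \<longrightarrow> (AE y in N. T f y = T g y)) \<and>
     (\<forall>f \<in> sum_space M \<rho>0 \<rho>1. \<forall>g \<in> sum_space M \<rho>0 \<rho>1. \<forall>a b.
        AE y in N. T (\<lambda>x. a * f x + b * g x) y = a * T f y + b * T g y) \<and>
     (\<forall>f \<in> sum_space M \<rho>0 \<rho>1. (AE x in M. 0 \<le> f x) \<longrightarrow> (AE y in N. 0 \<le> T f y)) \<and>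
     (\<exists>C. \<forall>f \<in> lat M \<rho>0. \<sigma>0 (T f) \<le> ennreal C * \<rho>0 f) \<and>
     (\<exists>C. \<forall>f \<in> lat M \<rho>1. \<sigma>1 (T f) \<le> ennreal C * \<rho>1 f)"

end

theory Submission
  imports Defs
begin

text \<open>The operator is already bounded below on the endpoint spaces. If \<open>f \<ge> 0\<close> and \<open>T f\<close> is in the unit
  ball of \<open>Y\<^sub>0\<close>, then for \<open>h\<close> in the unit ball of \<open>X\<^sub>1\<close> the Hoelder inequality
  \<open>T (f\<^sup>1\<^sup>-\<^sup>s h\<^sup>s) \<le> (T f)\<^sup>1\<^sup>-\<^sup>s (T h)\<^sup>s\<close> for positive operators and the invertibility of \<open>T\<close> at \<open>s = \<theta>s\<close> give a
  factorization \<open>f\<^sup>1\<^sup>-\<^sup>s h\<^sup>s \<le> C a\<^sup>1\<^sup>-\<^sup>s b\<^sup>s\<close> with \<open>a\<close>, \<open>b\<close> in the unit balls of \<open>X\<^sub>0\<close>, \<open>X\<^sub>1\<close>. Iterating with \<open>b\<close> in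
  the role of \<open>h\<close>, starting from a strictly positive \<open>h\<close>, multiplying the inequalities and taking
  \<open>n\<close>-th roots bounds \<open>f\<close> by geometric, hence by arithmetic means of elements of the unit ball of
  \<open>X\<^sub>0\<close>, up to a factor that is uniformly bounded on sets exhausting the space; the Fatou property then
  bounds the norm of \<open>f\<close> in \<open>X\<^sub>0\<close>. By order continuity \<open>T\<close> maps \<open>X\<^sub>j\<close> onto \<open>Y\<^sub>j\<close> and is injective on \<open>X\<^sub>0 + X\<^sub>1\<close>,
  so its inverse is a positive operator of the couples, and both operators act on all
  interpolation spaces.\<close>

section \<open>Weighted geometric means of real numbers\<close>

text \<open>Young's inequality for \<open>r powr s * a\<close> and
  \<open>r powr (s - 1) * b\<close>, whose powers of \<open>r\<close> cancel in the product. The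
  bound is linear in \<open>a\<close> and \<open>b\<close>, so a positive linear operator can be
  applied to it.\<close>

lemma powr_mult_le_weighted_sum:
  fixes a b r s :: real
  assumes "0 \<le> a" "0 \<le> b" "0 < r" "0 < s" "s < 1"
  shows "a powr (1 - s) * b powr s \<le> (1 - s) * r powr s * a + s * r powr (s - 1) * b"
proof (cases "a = 0 \<or> b = 0")
  case True
  then show ?thesis using assms by auto
next
  case False
  then have ab: "a > 0" "b > 0" using assms by auto
  have "(r powr s * a) powr (1 - s) * (r powr (s - 1) * b) powr s
      \<le> (1 - s) * (r powr s * a) + s * (r powr (s - 1) * b)"
    using assms ab by (intro Youngs_inequality_0) auto
  moreover have "(r powr s * a) powr (1 - s) * (r powr (s - 1) * b) powr s
      = (r powr (s * (1 - s)) * r powr ((s - 1) * s)) * (a powr (1 - s) * b powr s)"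
    using assms ab by (simp add: powr_mult powr_powr)
  moreover have "r powr (s * (1 - s)) * r powr ((s - 1) * s) = 1"
    using assms by (simp add: powr_add[symmetric] algebra_simps)
  ultimately show ?thesis by (simp add: mult.assoc)
qed

lemma powr_mult_le_add:
  fixes a b s :: real
  assumes "0 \<le> a" "0 \<le> b" "0 < s" "s < 1"
  shows "a powr (1 - s) * b powr s \<le> a + b"
proof -
  have "a powr (1 - s) * b powr s \<le> (1 - s) * a + s * b"
    using powr_mult_le_weighted_sum[of a b 1 s] assms by simp
  also have "\<dots> \<le> 1 * a + 1 * b"
    using assms by (intro add_mono mult_right_mono) auto
  finally show ?thesis by simp
qed

lemma powr_mult_scale:
  fixes a b c s :: real
  assumes "0 \<le> a" "0 \<le> b" "0 \<le> c"
  shows "(c * a) powr (1 - s) * (c * b) powr s = c * (a powr (1 - s) * b powr s)"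
proof (cases "c = 0")
  case False
  then have "c powr (1 - s) * c powr s = c"
    using assms by (simp add: powr_add[symmetric])
  then show ?thesis using assms by (simp add: powr_mult algebra_simps)
qed auto

lemma powr_mult_mono:
  fixes a b c d s :: real
  assumes "0 \<le> a" "a \<le> c" "0 \<le> b" "b \<le> d" "0 < s" "s < 1"
  shows "a powr (1 - s) * b powr s \<le> c powr (1 - s) * d powr s"
  using assms by (intro mult_mono powr_mono2) auto

text \<open>The geometric mean is the infimum of the weighted sums over \<open>r\<close>; for
  positive \<open>a\<close> and \<open>b\<close> it is attained at \<open>r = b / a\<close>.
  Continuity in \<open>r\<close> reduces real to rational parameters, and a shift by
  \<open>e\<close> covers vanishing \<open>a\<close> or \<open>b\<close>.\<close>

lemma le_powr_mult_of_rational_bounds: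
  fixes a b s z :: real
  assumes ab: "0 \<le> a" "0 \<le> b" and s: "0 < s" "s < 1"
    and z: "\<And>r. r \<in> \<rat> \<Longrightarrow> 0 < r \<Longrightarrow> z \<le> (1 - s) * r powr s * a + s * r powr (s - 1) * b"
  shows "z \<le> a powr (1 - s) * b powr s"
proof -
  \<comment> \<open>If the bound failed at a real \<open>r\<close>, right continuity would make it
    fail at some rational slightly larger than \<open>r\<close>.\<close>
  have real_r: "z \<le> (1 - s) * r powr s * a + s * r powr (s - 1) * b" if r: "0 < r" for r :: real
  proof (rule ccontr)
    define \<phi> where "\<phi> = (\<lambda>r. (1 - s) * r powr s * a + s * r powr (s - 1) * b)"
    assume "\<not> ?thesis"
    then have "\<phi> r < z" by (simp add: \<phi>_def)
    moreover have "(\<phi> \<longlongrightarrow> \<phi> r) (at_right r)"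
      unfolding \<phi>_def using r by (intro tendsto_intros) auto
    ultimately have "\<forall>\<^sub>F q in at_right r. \<phi> q < z" by (rule order_tendstoD(2)[rotated])
    then obtain q' where q': "q' > r" "\<And>q. r < q \<Longrightarrow> q < q' \<Longrightarrow> \<phi> q < z"
      unfolding eventually_at_right_field by blast
    obtain q where "q \<in> \<rat>" "r < q" "q < q'" using Rats_dense_in_real[OF q'(1)] by blast
    with q'(2)[of q] z[of q] r show False by (auto simp: \<phi>_def)
  qed
  have eps: "z \<le> (a + e) powr (1 - s) * (b + e) powr s" if e: "e > 0" for e
  proof -
    let ?A = "a + e" and ?B = "b + e"
    have pos: "?A > 0" "?B > 0" using e ab by auto
    \<comment> \<open>The minimizer: here each weighted term is its weight, \<open>1 - s\<close> or
      \<open>s\<close>, times the geometric mean.\<close>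
    let ?r = "?B / ?A"
    have r: "?r > 0" using pos by simp
    have "z \<le> (1 - s) * ?r powr s * a + s * ?r powr (s - 1) * b" by (rule real_r[OF r])
    also have "\<dots> \<le> (1 - s) * ?r powr s * ?A + s * ?r powr (s - 1) * ?B"
      using e s by (intro add_mono mult_left_mono) auto
    also have "\<dots> = (1 - s) * (?A powr (1 - s) * ?B powr s) + s * (?A powr (1 - s) * ?B powr s)"
    proof -
      have "(y / x) powr s * x = x powr (1 - s) * y powr s"
        "(y / x) powr (s - 1) * y = x powr (1 - s) * y powr s" if "x > 0" "y > 0" for x y :: real
        using that by (simp_all add: powr_divide powr_diff)
      then show ?thesis using pos by (simp only: mult.assoc)
    qed
    finally show ?thesis by (simp only: left_diff_distrib)
  qed
  have "((\<lambda>e. (a + e) powr (1 - s) * (b + e) powr s) \<longlongrightarrow> (a + 0) powr (1 - s) * (b + 0) powr s) (at_right 0)"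
    using ab s by (intro tendsto_intros tendsto_powr')
      (auto simp: eventually_at_right_field intro!: exI[of _ 1])
  then have "z \<le> (a + 0) powr (1 - s) * (b + 0) powr s"
    by (rule tendsto_lowerbound)
      (use eps in \<open>auto simp: eventually_at_right_field intro!: exI[of _ 1]\<close>)
  then show ?thesis by simp
qed

lemma power_powr_commute:
  fixes x t :: real
  assumes "0 \<le> x"
  shows "(x ^ n) powr t = (x powr t) ^ n"
  using assms by (induction n) (auto simp: powr_mult)

lemma power_powr_inverse:
  fixes x :: real
  assumes "0 \<le> x" "0 < n"
  shows "(x ^ n) powr (1 / real n) = x"
  using assms root_powr_inverse[of n "x ^ n"] real_root_power_cancel[of n x]
  by (cases "x = 0") auto

section \<open>Banach function lattices\<close>

locale function_lattice =
  fixes M :: "'a measure" and \<rho> :: "('a \<Rightarrow> real) \<Rightarrow> ennreal"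
  assumes banach: "banach_lattice M \<rho>"
begin

lemma norm_zero_iff: "f \<in> borel_measurable M \<Longrightarrow> \<rho> f = 0 \<longleftrightarrow> (AE x in M. f x = 0)"
  and norm_scale: "f \<in> borel_measurable M \<Longrightarrow> \<rho> (\<lambda>x. c * f x) = ennreal \<bar>c\<bar> * \<rho> f"
  and norm_add: "f \<in> borel_measurable M \<Longrightarrow> g \<in> borel_measurable M \<Longrightarrow>
    \<rho> (\<lambda>x. f x + g x) \<le> \<rho> f + \<rho> g"
  and lat_solid: "f \<in> borel_measurable M \<Longrightarrow> g \<in> lat M \<rho> \<Longrightarrow> AE x in M. \<bar>f x\<bar> \<le> \<bar>g x\<bar> \<Longrightarrow>
    f \<in> lat M \<rho>"
  and ex_positive: "\<exists>g \<in> lat M \<rho>. AE x in M. 0 < g x"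
  and complete: "\<forall>n. s n \<in> lat M \<rho> \<Longrightarrow>
    \<forall>e>0. \<exists>N. \<forall>m\<ge>N. \<forall>n\<ge>N. \<rho> (\<lambda>x. s m x - s n x) < ennreal e \<Longrightarrow>
    \<exists>f \<in> lat M \<rho>. (\<lambda>n. \<rho> (\<lambda>x. s n x - f x)) \<longlonglongrightarrow> 0"
  using banach unfolding banach_lattice_def by (blast+)

lemma norm_mono:
  assumes "f \<in> borel_measurable M" "g \<in> borel_measurable M" "AE x in M. \<bar>f x\<bar> \<le> \<bar>g x\<bar>"
  shows "\<rho> f \<le> \<rho> g"
proof (cases "\<rho> g < \<infinity>")
  case True
  then show ?thesis using banach assms unfolding banach_lattice_def lat_def by blast
qed (simp add: not_less top_unique)

lemma lat_measurable [measurable_dest]: "f \<in> lat M \<rho> \<Longrightarrow> f \<in> borel_measurable M"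
  by (simp add: lat_def)

lemma lat_finite: "f \<in> lat M \<rho> \<Longrightarrow> \<rho> f < \<infinity>"
  by (simp add: lat_def)

lemma lat_scale: "f \<in> lat M \<rho> \<Longrightarrow> (\<lambda>x. c * f x) \<in> lat M \<rho>"
  by (auto simp: lat_def norm_scale ennreal_mult_less_top)

lemma lat_add: "f \<in> lat M \<rho> \<Longrightarrow> g \<in> lat M \<rho> \<Longrightarrow> (\<lambda>x. f x + g x) \<in> lat M \<rho>"
  using norm_add[of f g] by (auto simp: lat_def intro: le_less_trans)

lemma lat_diff: "f \<in> lat M \<rho> \<Longrightarrow> g \<in> lat M \<rho> \<Longrightarrow> (\<lambda>x. f x - g x) \<in> lat M \<rho>"
  using lat_add[OF _ lat_scale[of g "-1"]] by simp

lemma lat_abs: "f \<in> lat M \<rho> \<Longrightarrow> (\<lambda>x. \<bar>f x\<bar>) \<in> lat M \<rho>"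
  by (rule lat_solid[of _ f]) (auto simp: lat_def)

lemma norm_abs: "f \<in> borel_measurable M \<Longrightarrow> \<rho> (\<lambda>x. \<bar>f x\<bar>) = \<rho> f"
  by (intro antisym norm_mono) auto

lemma norm_cong:
  "f \<in> borel_measurable M \<Longrightarrow> g \<in> borel_measurable M \<Longrightarrow> AE x in M. f x = g x \<Longrightarrow> \<rho> f = \<rho> g"
  by (intro antisym norm_mono) auto

lemma lat_AE_cong:
  "f \<in> lat M \<rho> \<Longrightarrow> g \<in> borel_measurable M \<Longrightarrow> AE x in M. g x = f x \<Longrightarrow> g \<in> lat M \<rho>"
  by (rule lat_solid[of _ f]) auto

text \<open>The constant only has to dominate the norm. This avoids division by a zero norm and lets
  one \<open>m\<close> normalize two functions in different lattices.\<close>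

lemma norm_normalize:
  assumes "f \<in> lat M \<rho>" "enn2real (\<rho> f) \<le> m" "0 < m"
  shows "\<rho> (\<lambda>x. inverse m * f x) \<le> 1"
proof -
  have "\<rho> (\<lambda>x. inverse m * f x) = ennreal (inverse m) * ennreal (enn2real (\<rho> f))"
    using assms lat_finite[OF assms(1)] by (subst norm_scale) (auto simp: lat_def)
  also have "\<dots> = ennreal (inverse m * enn2real (\<rho> f))"
    using assms by (simp add: ennreal_mult)
  also have "\<dots> \<le> ennreal 1"
    using assms by (intro ennreal_leI) (simp add: field_simps)
  finally show ?thesis by simp
qed

lemma norm_sum_le:
  assumes "\<And>i. i < (n::nat) \<Longrightarrow> f i \<in> borel_measurable M"
  shows "\<rho> (\<lambda>x. \<Sum>i<n. f i x) \<le> (\<Sum>i<n. \<rho> (f i))"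
  using assms
proof (induction n)
  case 0
  then show ?case using norm_zero_iff[of "\<lambda>x. 0"] by simp
next
  case (Suc n)
  have "\<rho> (\<lambda>x. (\<Sum>i<n. f i x) + f n x) \<le> \<rho> (\<lambda>x. \<Sum>i<n. f i x) + \<rho> (f n)"
    using Suc.prems by (intro norm_add borel_measurable_sum) auto
  also have "\<dots> \<le> (\<Sum>i<n. \<rho> (f i)) + \<rho> (f n)"
    using Suc by (intro add_right_mono) auto
  finally show ?case by simp
qed

lemma norm_le_limit_zero:
  assumes "f \<in> borel_measurable M" "\<And>n. \<rho> f \<le> a n" "a \<longlonglongrightarrow> 0"
  shows "AE x in M. f x = 0"
proof -
  have "\<rho> f \<le> 0" by (rule LIMSEQ_le_const[OF assms(3)]) (use assms(2) in auto)
  then show ?thesis using norm_zero_iff[OF assms(1)] by simp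
qed

text \<open>The bound \<open>A\<close> is the sum of the series \<open>\<Sum>n. \<bar>a n\<bar> / 2 ^ n\<close>.\<close>
lemma ex_common_bound:
  fixes a :: "nat \<Rightarrow> 'a \<Rightarrow> real"
  assumes a: "\<And>n. a n \<in> borel_measurable M" "\<And>n. \<rho> (a n) \<le> 1"
  obtains A where "A \<in> lat M \<rho>" "\<And>x. 0 \<le> A x" "\<And>n. AE x in M. \<bar>a n x\<bar> \<le> 2 ^ n * A x"
proof -
  note [measurable] = a(1)
  define s where "s n = (\<lambda>x. \<Sum>i<n. inverse (2 ^ i) * \<bar>a i x\<bar>)" for n :: nat
  have [measurable]: "s n \<in> borel_measurable M" for n
    unfolding s_def by measurable
  have term_le: "\<rho> (\<lambda>x. inverse (2 ^ i) * \<bar>a i x\<bar>) \<le> ennreal (inverse (2 ^ i))" for i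
  proof -
    have "\<rho> (\<lambda>x. inverse (2 ^ i) * \<bar>a i x\<bar>) = ennreal (inverse (2 ^ i)) * \<rho> (a i)"
      using a by (subst norm_scale) (auto simp: norm_abs)
    also have "\<dots> \<le> ennreal (inverse (2 ^ i)) * 1" using a(2) by (intro mult_left_mono) auto
    finally show ?thesis by simp
  qed
  have s_lat: "s n \<in> lat M \<rho>" for n
  proof -
    have "\<rho> (s n) \<le> (\<Sum>i<n. \<rho> (\<lambda>x. inverse (2 ^ i) * \<bar>a i x\<bar>))"
      unfolding s_def by (rule norm_sum_le) measurable
    also have "\<dots> \<le> (\<Sum>i<n. ennreal (inverse (2 ^ i)))" by (intro sum_mono term_le)
    also have "\<dots> < \<infinity>" by simp
    finally show ?thesis by (simp add: lat_def)
  qed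
  \<comment> \<open>The exact geometric partial sum is kept on the right so that the induction on
    \<open>d\<close> closes.\<close>
  have tail: "\<rho> (\<lambda>x. s (k + d) x - s k x) \<le> ennreal (2 * inverse (2 ^ k) - 2 * inverse (2 ^ (k + d)))" for k d
  proof (induction d)
    case 0
    then show ?case using norm_zero_iff[of "\<lambda>x. 0"] by simp
  next
    case (Suc d)
    have "\<rho> (\<lambda>x. s (k + Suc d) x - s k x)
        = \<rho> (\<lambda>x. (s (k + d) x - s k x) + inverse (2 ^ (k + d)) * \<bar>a (k + d) x\<bar>)"
      by (rule arg_cong[where f = \<rho>]) (simp add: s_def fun_eq_iff)
    also have "\<dots> \<le> \<rho> (\<lambda>x. s (k + d) x - s k x) + \<rho> (\<lambda>x. inverse (2 ^ (k + d)) * \<bar>a (k + d) x\<bar>)"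
      by (rule norm_add) measurable
    also have "\<dots> \<le> ennreal (2 * inverse (2 ^ k) - 2 * inverse (2 ^ (k + d))) + ennreal (inverse (2 ^ (k + d)))"
      by (intro add_mono Suc term_le)
    also have "\<dots> = ennreal (2 * inverse (2 ^ k) - 2 * inverse (2 ^ (k + d)) + inverse (2 ^ (k + d)))"
      by (rule ennreal_plus[symmetric]) (auto simp: field_simps power_add)
    also have "2 * inverse (2 ^ k) - 2 * inverse (2 ^ (k + d)) + inverse (2 ^ (k + d))
        = 2 * inverse (2 ^ k) - 2 * inverse (2 ^ (k + Suc d) :: real)"
      by simp
    finally show ?case .
  qed
  have tail': "\<rho> (\<lambda>x. s m x - s n x) \<le> ennreal (2 * inverse (2 ^ k))" if "k \<le> m" "k \<le> n" for k m n
  proof -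
    have *: "\<rho> (\<lambda>x. s m x - s n x) \<le> ennreal (2 * inverse (2 ^ k))" if "k \<le> n" "n \<le> m" for m n
    proof -
      have "\<rho> (\<lambda>x. s m x - s n x) \<le> ennreal (2 * inverse (2 ^ n) - 2 * inverse (2 ^ m))"
        using tail[of n "m - n"] that by simp
      also have "\<dots> \<le> ennreal (2 * inverse (2 ^ k))"
      proof (rule ennreal_leI)
        have "inverse (2 ^ n) \<le> inverse (2 ^ k :: real)" using that by (simp add: power_increasing)
        then have "2 * inverse (2 ^ n) - 2 * inverse (2 ^ m) \<le> 2 * inverse (2 ^ k) - (0::real)"
          by (intro diff_mono mult_left_mono) auto
        then show "2 * inverse (2 ^ n) - 2 * inverse (2 ^ m) \<le> 2 * inverse (2 ^ k :: real)" by simp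
      qed
      finally show ?thesis .
    qed
    show ?thesis
    proof (cases "n \<le> m")
      case True
      then show ?thesis using * that by blast
    next
      case False
      have "\<rho> (\<lambda>x. s m x - s n x) = \<rho> (\<lambda>x. s n x - s m x)"
        by (intro antisym norm_mono) auto
      then show ?thesis using * that False by simp
    qed
  qed
  have "\<exists>f \<in> lat M \<rho>. (\<lambda>n. \<rho> (\<lambda>x. s n x - f x)) \<longlonglongrightarrow> 0"
  proof (rule complete)
    show "\<forall>e>0. \<exists>N. \<forall>m\<ge>N. \<forall>n\<ge>N. \<rho> (\<lambda>x. s m x - s n x) < ennreal e"
    proof (intro allI impI)
      fix e :: real assume "e > 0"
      obtain k where "inverse (2 ^ k) < e / 2"
        using real_arch_pow_inv[of "e / 2" "1 / 2"] \<open>e > 0\<close> by (auto simp: field_simps)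
      then have "ennreal (2 * inverse (2 ^ k)) < ennreal e"
        using \<open>e > 0\<close> by (intro ennreal_lessI) auto
      then show "\<exists>N. \<forall>m\<ge>N. \<forall>n\<ge>N. \<rho> (\<lambda>x. s m x - s n x) < ennreal e"
        using tail' by (meson le_less_trans)
    qed
  qed (use s_lat in blast)
  then obtain A where A: "A \<in> lat M \<rho>" "(\<lambda>n. \<rho> (\<lambda>x. s n x - A x)) \<longlonglongrightarrow> 0" by blast
  have [measurable]: "A \<in> borel_measurable M" using A(1) by (rule lat_measurable)
  have s_mono: "s n x \<le> s m x" if "n \<le> m" for n m x
    unfolding s_def using that by (intro sum_mono2) auto
  \<comment> \<open>The positive part of \<open>s n - A\<close> is at most
    \<open>\<bar>s (m + n) - A\<bar>\<close>, because the partial sums increase. Its norm is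
    therefore bounded by a null sequence, and the norm limit \<open>A\<close> dominates every
    \<open>s n\<close>.\<close>
  have s_le: "AE x in M. s n x \<le> A x" for n
  proof -
    have "AE x in M. max 0 (s n x - A x) = 0"
    proof (rule norm_le_limit_zero)
      show "\<rho> (\<lambda>x. max 0 (s n x - A x)) \<le> \<rho> (\<lambda>x. s (m + n) x - A x)" for m
      proof (rule norm_mono)
        show "AE x in M. \<bar>max 0 (s n x - A x)\<bar> \<le> \<bar>s (m + n) x - A x\<bar>"
        proof (intro always_eventually allI)
          fix x
          show "\<bar>max 0 (s n x - A x)\<bar> \<le> \<bar>s (m + n) x - A x\<bar>"
            using s_mono[of n "m + n" x] by auto
        qed
      qed auto
      show "(\<lambda>m. \<rho> (\<lambda>x. s (m + n) x - A x)) \<longlonglongrightarrow> 0"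
        by (rule LIMSEQ_ignore_initial_segment[OF A(2)])
    qed auto
    then show ?thesis by eventually_elim (auto simp: max_def split: if_splits)
  qed
  \<comment> \<open>\<open>A\<close> is nonnegative only almost everywhere; its absolute value is so
    at every point.\<close>
  show ?thesis
  proof (rule that[of "\<lambda>x. \<bar>A x\<bar>"])
    show "AE x in M. \<bar>a n x\<bar> \<le> 2 ^ n * \<bar>A x\<bar>" for n
      using s_le[of "Suc n"]
    proof eventually_elim
      case (elim x)
      have "inverse (2 ^ n) * \<bar>a n x\<bar> \<le> s (Suc n) x"
        by (simp add: s_def sum_nonneg)
      also have "\<dots> \<le> \<bar>A x\<bar>" using elim by simp
      finally show ?case by (simp add: field_simps)
    qed
  qed (use lat_abs[OF A(1)] in auto)
qed

end

section \<open>Couples of lattices and Calderon products\<close>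

lemma sum_space_swap: "sum_space M \<rho>1 \<rho>0 = sum_space M \<rho>0 \<rho>1"
proof -
  have "sum_space M a b \<subseteq> sum_space M b a" for a b
  proof
    fix f assume "f \<in> sum_space M a b"
    then obtain f0 f1 where "f \<in> borel_measurable M" "f0 \<in> lat M a" "f1 \<in> lat M b"
      "AE x in M. f x = f0 x + f1 x" by (auto simp: sum_space_def)
    moreover from this have "AE x in M. f x = f1 x + f0 x" by (simp add: add.commute)
    ultimately show "f \<in> sum_space M b a" unfolding sum_space_def by blast
  qed
  then show ?thesis by blast
qed

text \<open>Exchanging the endpoints replaces \<theta> by \<open>1 - \<theta>\<close>. With
  \<open>sum_space_swap\<close> this transfers results about endpoint 0 to endpoint 1.\<close>

lemma calderon_swap:
  fixes M :: "'a measure"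
  shows "calderon M \<rho>1 \<rho>0 (1 - \<theta>) = calderon M \<rho>0 \<rho>1 \<theta>"
proof -
  have set_eq: "{l::real. l > 0 \<and> (\<exists>f0 \<in> borel_measurable M. \<exists>f1 \<in> borel_measurable M.
        \<rho>1 f0 \<le> 1 \<and> \<rho>0 f1 \<le> 1 \<and>
        (AE x in M. \<bar>f x\<bar> \<le> l * (\<bar>f0 x\<bar> powr (1 - (1 - \<theta>)) * \<bar>f1 x\<bar> powr (1 - \<theta>))))}
    = {l::real. l > 0 \<and> (\<exists>f0 \<in> borel_measurable M. \<exists>f1 \<in> borel_measurable M.
        \<rho>0 f0 \<le> 1 \<and> \<rho>1 f1 \<le> 1 \<and>
        (AE x in M. \<bar>f x\<bar> \<le> l * (\<bar>f0 x\<bar> powr (1 - \<theta>) * \<bar>f1 x\<bar> powr \<theta>)))}" for f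
  proof -
    have "\<bar>f0 x\<bar> powr (1 - (1 - \<theta>)) * \<bar>f1 x\<bar> powr (1 - \<theta>) = \<bar>f1 x\<bar> powr (1 - \<theta>) * \<bar>f0 x\<bar> powr \<theta>"
      for f0 f1 :: "'a \<Rightarrow> real" and x
      by simp
    then show ?thesis by (simp only:) blast
  qed
  have "calderon_norm M \<rho>1 \<rho>0 (1 - \<theta>) f = calderon_norm M \<rho>0 \<rho>1 \<theta> f" for f
    unfolding calderon_norm_def set_eq ..
  then show ?thesis by (simp add: calderon_def lat_def)
qed

locale lattice_couple =
  L0: function_lattice M \<rho>0 + L1: function_lattice M \<rho>1
  for M :: "'a measure" and \<rho>0 \<rho>1 :: "('a \<Rightarrow> real) \<Rightarrow> ennreal"
begin

abbreviation E where "E \<equiv> sum_space M \<rho>0 \<rho>1"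

lemma sum_space_measurable [measurable_dest]: "f \<in> E \<Longrightarrow> f \<in> borel_measurable M"
  by (simp add: sum_space_def)

text \<open>Riesz decomposition: clipping \<open>f\<close> to the interval from
  \<open>- \<bar>a\<bar>\<close> to \<open>\<bar>a\<bar>\<close> leaves a remainder bounded by
  \<open>\<bar>b\<bar>\<close>. Membership in the sum space thus becomes a question of
  domination.\<close>

lemma sum_spaceI:
  assumes [measurable]: "f \<in> borel_measurable M" and a: "a \<in> lat M \<rho>0" and b: "b \<in> lat M \<rho>1"
    and le: "AE x in M. \<bar>f x\<bar> \<le> \<bar>a x\<bar> + \<bar>b x\<bar>"
  shows "f \<in> E"
proof -
  note [measurable] = L0.lat_measurable[OF a] L1.lat_measurable[OF b]
  let ?f0 = "\<lambda>x. max (- \<bar>a x\<bar>) (min (f x) \<bar>a x\<bar>)"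
  have "?f0 \<in> lat M \<rho>0" by (rule L0.lat_solid[OF _ a]) auto
  moreover have "(\<lambda>x. f x - ?f0 x) \<in> lat M \<rho>1"
    by (rule L1.lat_solid[OF _ b]) (use le in \<open>auto elim!: eventually_mono\<close>)
  ultimately show ?thesis
    unfolding sum_space_def using assms(1) by (intro CollectI conjI bexI[of _ ?f0] bexI[of _ "\<lambda>x. f x - ?f0 x"]) auto
qed

lemma sum_spaceE:
  assumes "f \<in> E"
  obtains a b where "a \<in> lat M \<rho>0" "b \<in> lat M \<rho>1" "\<And>x. 0 \<le> a x" "\<And>x. 0 \<le> b x"
    "AE x in M. \<bar>f x\<bar> \<le> a x + b x"
proof -
  obtain f0 f1 where "f0 \<in> lat M \<rho>0" "f1 \<in> lat M \<rho>1" "AE x in M. f x = f0 x + f1 x"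
    using assms by (auto simp: sum_space_def)
  then show ?thesis
    by (intro that[of "\<lambda>x. \<bar>f0 x\<bar>" "\<lambda>x. \<bar>f1 x\<bar>"] L0.lat_abs L1.lat_abs)
      (auto elim!: eventually_mono)
qed

lemma zero_lat: "(\<lambda>x. 0) \<in> lat M \<rho>0" "(\<lambda>x. 0) \<in> lat M \<rho>1"
  using L0.norm_zero_iff[of "\<lambda>x. 0"] L1.norm_zero_iff[of "\<lambda>x. 0"] by (auto simp: lat_def)

lemma lat0_sum_space: "f \<in> lat M \<rho>0 \<Longrightarrow> f \<in> E"
  by (rule sum_spaceI[OF _ _ zero_lat(2)]) (auto simp: lat_def)

lemma lat1_sum_space: "f \<in> lat M \<rho>1 \<Longrightarrow> f \<in> E"
  by (rule sum_spaceI[OF _ zero_lat(1)]) (auto simp: lat_def)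

lemma sum_space_solid:
  assumes "f \<in> borel_measurable M" "g \<in> E" "AE x in M. \<bar>f x\<bar> \<le> \<bar>g x\<bar>"
  shows "f \<in> E"
proof -
  obtain a b where ab: "a \<in> lat M \<rho>0" "b \<in> lat M \<rho>1" "\<And>x. 0 \<le> a x" "\<And>x. 0 \<le> b x"
    "AE x in M. \<bar>g x\<bar> \<le> a x + b x" using assms(2) by (rule sum_spaceE) blast
  show ?thesis
    by (rule sum_spaceI[OF assms(1) ab(1,2)])
      (use assms(3) ab(5) in eventually_elim, use ab(3,4) in auto)
qed

lemma sum_space_lincomb:
  assumes f: "f \<in> E" and g: "g \<in> E"
  shows "(\<lambda>x. c * f x + d * g x) \<in> E"
proof -
  obtain a b where ab: "a \<in> lat M \<rho>0" "b \<in> lat M \<rho>1" "\<And>x. 0 \<le> a x" "\<And>x. 0 \<le> b x"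
    "AE x in M. \<bar>f x\<bar> \<le> a x + b x" using f by (rule sum_spaceE) blast
  obtain a' b' where ab': "a' \<in> lat M \<rho>0" "b' \<in> lat M \<rho>1" "\<And>x. 0 \<le> a' x" "\<And>x. 0 \<le> b' x"
    "AE x in M. \<bar>g x\<bar> \<le> a' x + b' x" using g by (rule sum_spaceE) blast
  show ?thesis
  proof (rule sum_spaceI)
    show "(\<lambda>x. \<bar>c\<bar> * a x + \<bar>d\<bar> * a' x) \<in> lat M \<rho>0" "(\<lambda>x. \<bar>c\<bar> * b x + \<bar>d\<bar> * b' x) \<in> lat M \<rho>1"
      using ab ab' by (auto intro!: L0.lat_add L1.lat_add L0.lat_scale L1.lat_scale)
    show "AE x in M. \<bar>c * f x + d * g x\<bar> \<le> \<bar>\<bar>c\<bar> * a x + \<bar>d\<bar> * a' x\<bar> + \<bar>\<bar>c\<bar> * b x + \<bar>d\<bar> * b' x\<bar>"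
      using ab(5) ab'(5)
    proof eventually_elim
      case (elim x)
      have "\<bar>c * f x + d * g x\<bar> \<le> \<bar>c\<bar> * \<bar>f x\<bar> + \<bar>d\<bar> * \<bar>g x\<bar>"
        by (rule order_trans[OF abs_triangle_ineq]) (simp add: abs_mult)
      also have "\<dots> \<le> \<bar>c\<bar> * (a x + b x) + \<bar>d\<bar> * (a' x + b' x)"
        using elim by (intro add_mono mult_left_mono) auto
      finally show ?case using ab(3,4)[of x] ab'(3,4)[of x] by (simp add: algebra_simps)
    qed
    show "(\<lambda>x. c * f x + d * g x) \<in> borel_measurable M"
      using sum_space_measurable[OF f] sum_space_measurable[OF g] by measurable
  qed
qed

lemma sum_space_add: "f \<in> E \<Longrightarrow> g \<in> E \<Longrightarrow> (\<lambda>x. f x + g x) \<in> E"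
  using sum_space_lincomb[of f g 1 1] by simp

lemma sum_space_diff: "f \<in> E \<Longrightarrow> g \<in> E \<Longrightarrow> (\<lambda>x. f x - g x) \<in> E"
  using sum_space_lincomb[of f g 1 "-1"] by simp

lemma sum_space_scale: "f \<in> E \<Longrightarrow> (\<lambda>x. c * f x) \<in> E"
  using sum_space_lincomb[of f f c 0] by simp

lemma sum_space_abs: "f \<in> E \<Longrightarrow> (\<lambda>x. \<bar>f x\<bar>) \<in> E"
  by (rule sum_space_solid[of _ f]) (auto dest: sum_space_measurable)

lemma sum_space_powr_mult:
  assumes f: "f \<in> E" and g: "g \<in> E" and \<theta>: "0 < \<theta>" "\<theta> < 1"
  shows "(\<lambda>x. \<bar>f x\<bar> powr (1 - \<theta>) * \<bar>g x\<bar> powr \<theta>) \<in> E"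
proof (rule sum_space_solid[OF _ sum_space_add[OF sum_space_abs[OF f] sum_space_abs[OF g]]])
  show "AE x in M. \<bar>\<bar>f x\<bar> powr (1 - \<theta>) * \<bar>g x\<bar> powr \<theta>\<bar> \<le> \<bar>\<bar>f x\<bar> + \<bar>g x\<bar>\<bar>"
    using powr_mult_le_add[OF _ _ \<theta>] by (auto simp: abs_mult)
qed (use sum_space_measurable[OF f] sum_space_measurable[OF g] in measurable)

text \<open>The minimum of two strictly positive elements. It serves as a truncation weight: for
  nonnegative \<open>p\<close> the functions \<open>min p (k * u)\<close> lie in both endpoint
  spaces and increase to \<open>p\<close> almost everywhere.\<close>

lemma ex_positive_common:
  obtains u where "u \<in> lat M \<rho>0" "u \<in> lat M \<rho>1" "\<And>x. 0 \<le> u x" "AE x in M. 0 < u x"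
proof -
  obtain a where a: "a \<in> lat M \<rho>0" "AE x in M. 0 < a x" using L0.ex_positive by blast
  obtain b where b: "b \<in> lat M \<rho>1" "AE x in M. 0 < b x" using L1.ex_positive by blast
  note [measurable] = L0.lat_measurable[OF a(1)] L1.lat_measurable[OF b(1)]
  let ?u = "\<lambda>x. min \<bar>a x\<bar> \<bar>b x\<bar>"
  show ?thesis
  proof (rule that[of ?u])
    show "?u \<in> lat M \<rho>0" by (rule L0.lat_solid[OF _ a(1)]) auto
    show "?u \<in> lat M \<rho>1" by (rule L1.lat_solid[OF _ b(1)]) auto
    show "AE x in M. 0 < ?u x" using a(2) b(2) by eventually_elim auto
  qed auto
qed

lemma calderonI:
  assumes "f \<in> borel_measurable M" and a: "a \<in> lat M \<rho>0" and b: "b \<in> lat M \<rho>1"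
    and le: "AE x in M. \<bar>f x\<bar> \<le> \<bar>a x\<bar> powr (1 - \<theta>) * \<bar>b x\<bar> powr \<theta>"
  shows "f \<in> calderon M \<rho>0 \<rho>1 \<theta>"
proof -
  note [measurable] = L0.lat_measurable[OF a] L1.lat_measurable[OF b]
  \<comment> \<open>One constant for both factors: the geometric mean is homogeneous of degree one,
    so dividing \<open>a\<close> and \<open>b\<close> by \<open>m\<close> costs exactly the factor
    \<open>m\<close>.\<close>
  define m where "m = max 1 (max (enn2real (\<rho>0 a)) (enn2real (\<rho>1 b)))"
  have m: "m > 0" by (simp add: m_def)
  let ?a = "\<lambda>x. inverse m * a x" and ?b = "\<lambda>x. inverse m * b x"
  have ab: "\<rho>0 ?a \<le> 1" "\<rho>1 ?b \<le> 1"
    using m by (intro L0.norm_normalize[OF a] L1.norm_normalize[OF b]; simp add: m_def)+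
  have eq: "m * (\<bar>?a x\<bar> powr (1 - \<theta>) * \<bar>?b x\<bar> powr \<theta>) = \<bar>a x\<bar> powr (1 - \<theta>) * \<bar>b x\<bar> powr \<theta>" for x
    using m powr_mult_scale[of "\<bar>a x\<bar>" "\<bar>b x\<bar>" "inverse m" \<theta>] by (simp add: abs_mult)
  have "calderon_norm M \<rho>0 \<rho>1 \<theta> f \<le> ennreal m"
    unfolding calderon_norm_def
  proof (rule INF_lower, intro CollectI conjI bexI)
    show "AE x in M. \<bar>f x\<bar> \<le> m * (\<bar>?a x\<bar> powr (1 - \<theta>) * \<bar>?b x\<bar> powr \<theta>)"
      using le by (simp only: eq)
  qed (use m ab in auto)
  also have "ennreal m < \<infinity>" by simp
  finally show ?thesis using assms(1) by (simp add: calderon_def lat_def)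
qed

lemma calderonE:
  assumes "f \<in> calderon M \<rho>0 \<rho>1 \<theta>"
  obtains a b where "f \<in> borel_measurable M" "a \<in> lat M \<rho>0" "b \<in> lat M \<rho>1" "\<And>x. 0 \<le> a x" "\<And>x. 0 \<le> b x"
    "AE x in M. \<bar>f x\<bar> \<le> a x powr (1 - \<theta>) * b x powr \<theta>"
proof -
  have "calderon_norm M \<rho>0 \<rho>1 \<theta> f < \<infinity>" using assms by (simp add: calderon_def lat_def)
  then obtain l f0 f1 where *: "l > 0" "f0 \<in> borel_measurable M" "f1 \<in> borel_measurable M"
    "\<rho>0 f0 \<le> 1" "\<rho>1 f1 \<le> 1" "AE x in M. \<bar>f x\<bar> \<le> l * (\<bar>f0 x\<bar> powr (1 - \<theta>) * \<bar>f1 x\<bar> powr \<theta>)"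
    unfolding calderon_norm_def Inf_less_iff by auto
  have "f0 \<in> lat M \<rho>0" "f1 \<in> lat M \<rho>1"
    using * by (auto simp: lat_def intro: le_less_trans)
  then have "(\<lambda>x. l * \<bar>f0 x\<bar>) \<in> lat M \<rho>0" "(\<lambda>x. l * \<bar>f1 x\<bar>) \<in> lat M \<rho>1"
    by (auto intro: L0.lat_scale L0.lat_abs L1.lat_scale L1.lat_abs)
  moreover have "f \<in> borel_measurable M" using assms by (simp add: calderon_def lat_def)
  moreover have "l * (\<bar>f0 x\<bar> powr (1 - \<theta>) * \<bar>f1 x\<bar> powr \<theta>)
      = (l * \<bar>f0 x\<bar>) powr (1 - \<theta>) * (l * \<bar>f1 x\<bar>) powr \<theta>" for x
    using *(1) by (subst powr_mult_scale) auto
  ultimately show ?thesis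
    using * by (intro that[of "\<lambda>x. l * \<bar>f0 x\<bar>" "\<lambda>x. l * \<bar>f1 x\<bar>"]) auto
qed

lemma calderon_subset_sum_space:
  assumes "0 < \<theta>" "\<theta> < 1"
  shows "calderon M \<rho>0 \<rho>1 \<theta> \<subseteq> E"
proof
  fix f assume "f \<in> calderon M \<rho>0 \<rho>1 \<theta>"
  then obtain a b where ab: "f \<in> borel_measurable M" "a \<in> lat M \<rho>0" "b \<in> lat M \<rho>1"
    "\<And>x. 0 \<le> a x" "\<And>x. 0 \<le> b x"
    "AE x in M. \<bar>f x\<bar> \<le> a x powr (1 - \<theta>) * b x powr \<theta>" by (rule calderonE) blast
  show "f \<in> E"
  proof (rule sum_spaceI[OF ab(1-3)])
    show "AE x in M. \<bar>f x\<bar> \<le> \<bar>a x\<bar> + \<bar>b x\<bar>"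
      using ab(6)
    proof eventually_elim
      case (elim x)
      then show ?case using powr_mult_le_add[OF ab(4,5) assms, of x x] ab(4,5)[of x] by simp
    qed
  qed
qed

lemma calderon_solid:
  assumes "g \<in> borel_measurable M" "f \<in> calderon M \<rho>0 \<rho>1 \<theta>" "AE x in M. \<bar>g x\<bar> \<le> \<bar>f x\<bar>"
  shows "g \<in> calderon M \<rho>0 \<rho>1 \<theta>"
proof -
  obtain a b where ab: "a \<in> lat M \<rho>0" "b \<in> lat M \<rho>1"
    "\<And>x. 0 \<le> a x" "\<And>x. 0 \<le> b x"
    "AE x in M. \<bar>f x\<bar> \<le> a x powr (1 - \<theta>) * b x powr \<theta>" using assms(2) by (rule calderonE) blast
  show ?thesis
    by (rule calderonI[OF assms(1) ab(1,2)])
      (use assms(3) ab(5) in eventually_elim, use ab(3,4) in auto)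
qed

lemma lat_Int_calderon: "f \<in> lat M \<rho>0 \<Longrightarrow> f \<in> lat M \<rho>1 \<Longrightarrow> f \<in> calderon M \<rho>0 \<rho>1 \<theta>"
  by (rule calderonI[of f f f]) (auto simp: lat_def powr_add[symmetric])

text \<open>The pair \<open>a + a'\<close>, \<open>b + b'\<close> dominates both factorizations at
  once, and the factor \<open>k\<close> is absorbed into it by homogeneity.\<close>

lemma calderon_lincomb:
  assumes f: "f \<in> calderon M \<rho>0 \<rho>1 \<theta>" and g: "g \<in> calderon M \<rho>0 \<rho>1 \<theta>" and \<theta>: "0 < \<theta>" "\<theta> < 1"
  shows "(\<lambda>x. c * f x + d * g x) \<in> calderon M \<rho>0 \<rho>1 \<theta>"
proof -
  obtain a b where ab: "f \<in> borel_measurable M" "a \<in> lat M \<rho>0" "b \<in> lat M \<rho>1"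
    "\<And>x. 0 \<le> a x" "\<And>x. 0 \<le> b x"
    "AE x in M. \<bar>f x\<bar> \<le> a x powr (1 - \<theta>) * b x powr \<theta>" using f by (rule calderonE) blast
  obtain a' b' where ab': "g \<in> borel_measurable M" "a' \<in> lat M \<rho>0" "b' \<in> lat M \<rho>1"
    "\<And>x. 0 \<le> a' x" "\<And>x. 0 \<le> b' x"
    "AE x in M. \<bar>g x\<bar> \<le> a' x powr (1 - \<theta>) * b' x powr \<theta>" using g by (rule calderonE) blast
  define k where "k = \<bar>c\<bar> + \<bar>d\<bar>"
  show ?thesis
  proof (rule calderonI)
    show "(\<lambda>x. k * (a x + a' x)) \<in> lat M \<rho>0" "(\<lambda>x. k * (b x + b' x)) \<in> lat M \<rho>1"
      using ab ab' by (auto intro!: L0.lat_add L1.lat_add L0.lat_scale L1.lat_scale)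
    show "AE x in M. \<bar>c * f x + d * g x\<bar>
        \<le> \<bar>k * (a x + a' x)\<bar> powr (1 - \<theta>) * \<bar>k * (b x + b' x)\<bar> powr \<theta>"
      using ab(6) ab'(6)
    proof eventually_elim
      case (elim x)
      note nn = ab(4,5)[of x] ab'(4,5)[of x]
      let ?R = "(a x + a' x) powr (1 - \<theta>) * (b x + b' x) powr \<theta>"
      have "\<bar>f x\<bar> \<le> ?R"
        using nn \<theta> by (intro order_trans[OF elim(1)] powr_mult_mono) auto
      moreover have "\<bar>g x\<bar> \<le> ?R"
        using nn \<theta> by (intro order_trans[OF elim(2)] powr_mult_mono) auto
      ultimately have "\<bar>c\<bar> * \<bar>f x\<bar> + \<bar>d\<bar> * \<bar>g x\<bar> \<le> \<bar>c\<bar> * ?R + \<bar>d\<bar> * ?R"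
        by (intro add_mono mult_left_mono) auto
      moreover have "\<bar>c * f x + d * g x\<bar> \<le> \<bar>c\<bar> * \<bar>f x\<bar> + \<bar>d\<bar> * \<bar>g x\<bar>"
        by (rule order_trans[OF abs_triangle_ineq]) (simp add: abs_mult)
      moreover have "\<bar>c\<bar> * ?R + \<bar>d\<bar> * ?R = k * ?R" by (simp add: k_def algebra_simps)
      moreover have "k * ?R = \<bar>k * (a x + a' x)\<bar> powr (1 - \<theta>) * \<bar>k * (b x + b' x)\<bar> powr \<theta>"
        using nn by (subst powr_mult_scale[symmetric]) (auto simp: k_def)
      ultimately show ?case by linarith
    qed
    show "(\<lambda>x. c * f x + d * g x) \<in> borel_measurable M"
      using ab(1) ab'(1) by measurable
  qed
qed

end

section \<open>Cancellation of a factor of a Calderon product\<close>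

context lattice_couple
begin

text \<open>Raised to the power \<open>1 / (1 - s)\<close>, the \<open>n\<close>-th inequality reads
  \<open>\<bar>f\<bar> * \<bar>h n\<bar> powr t \<le> D * (\<bar>a n\<bar> * \<bar>h (Suc n)\<bar>
  powr t)\<close>. The product of the first \<open>n\<close> of them telescopes in \<open>h\<close>
  and leaves \<open>h 0\<close> and \<open>h n\<close> only. Where \<open>B \<le> 2 ^ n * h0\<close>
  one has \<open>\<bar>h n\<bar> \<le> 4 ^ n * h0\<close>, so the \<open>n\<close>-th root costs no
  more than \<open>4 powr t\<close>.\<close>

lemma norm_bound_of_factorization:
  assumes fatou: "fatou M \<rho>0"
    and f [measurable]: "f \<in> borel_measurable M"
    and C: "0 < C" and s: "0 < s" "s < 1"
    and factor: "\<And>h. h \<in> borel_measurable M \<Longrightarrow> \<rho>1 h \<le> 1 \<Longrightarrow>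
      \<exists>a\<in>borel_measurable M. \<exists>b\<in>borel_measurable M. \<rho>0 a \<le> 1 \<and> \<rho>1 b \<le> 1 \<and>
        (AE x in M. \<bar>f x\<bar> powr (1 - s) * \<bar>h x\<bar> powr s \<le> C * (\<bar>a x\<bar> powr (1 - s) * \<bar>b x\<bar> powr s))"
  shows "\<rho>0 f \<le> ennreal (C powr (1 / (1 - s)) * 4 powr (s / (1 - s)))"
proof -
  define t where "t = s / (1 - s)"
  define D where "D = C powr (1 / (1 - s))"
  have t: "t > 0" using s by (simp add: t_def)
  have D: "D > 0" using C by (simp add: D_def)
  obtain k where k: "k \<in> lat M \<rho>1" "AE x in M. 0 < k x" using L1.ex_positive by blast
  define m where "m = max 1 (enn2real (\<rho>1 k))"
  define h0 where "h0 = (\<lambda>x. inverse m * k x)"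
  have m: "m > 0" by (simp add: m_def)
  have h0: "h0 \<in> borel_measurable M" "\<rho>1 h0 \<le> 1" "AE x in M. 0 < h0 x"
  proof -
    show "h0 \<in> borel_measurable M" using L1.lat_measurable[OF k(1)] by (simp add: h0_def)
    show "\<rho>1 h0 \<le> 1" unfolding h0_def
      by (rule L1.norm_normalize[OF k(1)]) (auto simp: m_def)
    show "AE x in M. 0 < h0 x" using k(2) m by (auto simp: h0_def elim!: eventually_mono)
  qed
  define Q where "Q h a b \<longleftrightarrow> a \<in> borel_measurable M \<and> b \<in> borel_measurable M \<and> \<rho>0 a \<le> 1 \<and> \<rho>1 b \<le> 1 \<and>
        (AE x in M. \<bar>f x\<bar> powr (1 - s) * \<bar>h x\<bar> powr s \<le> C * (\<bar>a x\<bar> powr (1 - s) * \<bar>b x\<bar> powr s))"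
    for h a b
  \<comment> \<open>Dependent choice: \<open>h (Suc n)\<close> is the second factor obtained from
    \<open>h n\<close>. The conjunct with \<open>n = 0\<close> pins the start at the strictly
    positive \<open>h0\<close>, which can later be cancelled.\<close>
  have "\<exists>h::nat \<Rightarrow> 'a \<Rightarrow> real. \<forall>n. (h n \<in> borel_measurable M \<and> \<rho>1 (h n) \<le> 1 \<and> (n = 0 \<longrightarrow> h n = h0)) \<and>
    (\<exists>a. Q (h n) a (h (Suc n)))"
  proof (rule dependent_nat_choice)
    show "\<exists>h. h \<in> borel_measurable M \<and> \<rho>1 h \<le> 1 \<and> (0 = (0::nat) \<longrightarrow> h = h0)" using h0 by blast
    show "\<exists>y. (y \<in> borel_measurable M \<and> \<rho>1 y \<le> 1 \<and> (Suc n = 0 \<longrightarrow> y = h0)) \<and> (\<exists>a. Q x a y)"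
      if "x \<in> borel_measurable M \<and> \<rho>1 x \<le> 1 \<and> (n = 0 \<longrightarrow> x = h0)" for x n
      using factor[of x] that unfolding Q_def by blast
  qed
  then obtain h where h: "\<And>n. h n \<in> borel_measurable M" "\<And>n. \<rho>1 (h n) \<le> 1" "h 0 = h0"
    and "\<And>n. \<exists>a. Q (h n) a (h (Suc n))" by blast
  then obtain a where Q: "\<And>n. Q (h n) (a n) (h (Suc n))" by metis
  have a: "\<And>n. a n \<in> borel_measurable M" "\<And>n. \<rho>0 (a n) \<le> 1"
    and ineq: "\<And>n. AE x in M. \<bar>f x\<bar> powr (1 - s) * \<bar>h n x\<bar> powr s \<le> C * (\<bar>a n x\<bar> powr (1 - s) * \<bar>h (Suc n) x\<bar> powr s)"
    using Q unfolding Q_def by blast+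
  note [measurable] = a(1) h(1) h0(1)
  \<comment> \<open>A single function controls all \<open>h n\<close>; the growth
    \<open>2 ^ n\<close> becomes a constant after the \<open>n\<close>-th root.\<close>
  obtain B where B: "B \<in> lat M \<rho>1" "\<And>x. 0 \<le> B x" "\<And>n. AE x in M. \<bar>h n x\<bar> \<le> 2 ^ n * B x"
    by (rule L1.ex_common_bound[of h, OF h(1,2)]) blast
  note [measurable] = L1.lat_measurable[OF B(1)]
  have pw: "y * z powr t \<le> D * (v * w powr t)"
    if "y powr (1 - s) * z powr s \<le> C * (v powr (1 - s) * w powr s)" "0 \<le> y" "0 \<le> z" "0 \<le> v" "0 \<le> w"
    for y z v w :: real
  proof -
    have e: "((p powr (1 - s)) * (q powr s)) powr (1 / (1 - s)) = p * q powr t" if "0 \<le> p" "0 \<le> q" for p q :: real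
      using that s by (simp add: powr_mult powr_powr t_def)
    have "(y powr (1 - s) * z powr s) powr (1 / (1 - s)) \<le> (C * (v powr (1 - s) * w powr s)) powr (1 / (1 - s))"
      using that s by (intro powr_mono2) auto
    also have "\<dots> = D * ((v powr (1 - s) * w powr s) powr (1 / (1 - s)))"
      using C by (simp add: powr_mult D_def)
    finally show ?thesis using e that by simp
  qed
  \<comment> \<open>The sets where \<open>B \<le> 2 ^ n * h0\<close> increase to the whole space up
    to a null set, because \<open>h0\<close> is positive almost everywhere.\<close>
  define F where "F n = (\<lambda>x. if B x \<le> 2 ^ n * h0 x then \<bar>f x\<bar> else 0)" for n :: nat
  have [measurable]: "F n \<in> borel_measurable M" for n unfolding F_def by measurable
  have F_norm: "\<rho>0 (F n) \<le> ennreal (D * 4 powr t)" if n: "n > 0" for n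
  proof -
    have "AE x in M. \<forall>i. \<bar>f x\<bar> powr (1 - s) * \<bar>h i x\<bar> powr s \<le> C * (\<bar>a i x\<bar> powr (1 - s) * \<bar>h (Suc i) x\<bar> powr s)"
      using ineq by (simp add: AE_all_countable)
    moreover have "AE x in M. \<forall>i. \<bar>h i x\<bar> \<le> 2 ^ i * B x"
      using B(3) by (simp add: AE_all_countable)
    ultimately have "AE x in M. \<bar>F n x\<bar> \<le> \<bar>D * 4 powr t * (inverse (real n) * (\<Sum>i<n. \<bar>a i x\<bar>))\<bar>"
      using h0(3)
    proof eventually_elim
      case (elim x)
      have iter: "\<bar>f x\<bar> ^ j * h0 x powr t \<le> D ^ j * (\<Prod>i<j. \<bar>a i x\<bar>) * \<bar>h j x\<bar> powr t" for j
      proof (induction j)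
        case 0
        then show ?case using elim(3) by (simp add: h(3))
      next
        case (Suc j)
        have "\<bar>f x\<bar> ^ Suc j * h0 x powr t \<le> \<bar>f x\<bar> * (D ^ j * (\<Prod>i<j. \<bar>a i x\<bar>) * \<bar>h j x\<bar> powr t)"
          using mult_left_mono[OF Suc, of "\<bar>f x\<bar>"] by (simp add: mult.assoc)
        also have "\<dots> = D ^ j * (\<Prod>i<j. \<bar>a i x\<bar>) * (\<bar>f x\<bar> * \<bar>h j x\<bar> powr t)" by (simp add: algebra_simps)
        also have "\<dots> \<le> D ^ j * (\<Prod>i<j. \<bar>a i x\<bar>) * (D * (\<bar>a j x\<bar> * \<bar>h (Suc j) x\<bar> powr t))"
          using elim(1) D by (intro mult_left_mono pw mult_nonneg_nonneg prod_nonneg) auto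
        finally show ?case by (simp add: algebra_simps)
      qed
      show ?case
      proof (cases "B x \<le> 2 ^ n * h0 x")
        case True
        have "\<bar>h n x\<bar> \<le> 2 ^ n * (2 ^ n * h0 x)"
          using elim(2) True by (meson order_trans mult_left_mono zero_le_power zero_le_numeral)
        also have "\<dots> = 4 ^ n * h0 x" by (simp add: power_mult_distrib[symmetric] mult.assoc[symmetric])
        finally have "\<bar>h n x\<bar> powr t \<le> (4 ^ n * h0 x) powr t"
          using t by (intro powr_mono2) auto
        also have "\<dots> = (4 powr t) ^ n * h0 x powr t"
          using elim(3) by (simp add: powr_mult power_powr_commute)
        finally have hn: "\<bar>h n x\<bar> powr t \<le> (4 powr t) ^ n * h0 x powr t" .
        have "\<bar>f x\<bar> ^ n * h0 x powr t \<le> D ^ n * (\<Prod>i<n. \<bar>a i x\<bar>) * ((4 powr t) ^ n * h0 x powr t)"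
          using D by (intro order_trans[OF iter] mult_left_mono hn mult_nonneg_nonneg prod_nonneg) auto
        also have "\<dots> = ((D * 4 powr t) ^ n * (\<Prod>i<n. \<bar>a i x\<bar>)) * h0 x powr t"
          by (simp add: algebra_simps power_mult_distrib)
        finally have "\<bar>f x\<bar> ^ n \<le> (D * 4 powr t) ^ n * (\<Prod>i<n. \<bar>a i x\<bar>)"
          using elim(3) by simp
        then have "(\<bar>f x\<bar> ^ n) powr (1 / n) \<le> ((D * 4 powr t) ^ n * (\<Prod>i<n. \<bar>a i x\<bar>)) powr (1 / n)"
          by (intro powr_mono2) auto
        also have "\<dots> = ((D * 4 powr t) ^ n) powr (1 / n) * (\<Prod>i<n. \<bar>a i x\<bar>) powr (1 / n)"
          using D by (intro powr_mult)
        also have "(\<bar>f x\<bar> ^ n) powr (1 / n) = \<bar>f x\<bar>"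
          using n by (simp add: power_powr_inverse)
        also have "((D * 4 powr t) ^ n) powr (1 / n) = D * 4 powr t"
          using D n by (intro power_powr_inverse) auto
        \<comment> \<open>The arithmetic mean replaces the geometric one because its norm is
          controlled by the triangle inequality.\<close>
        also have "D * 4 powr t * (\<Prod>i<n. \<bar>a i x\<bar>) powr (1 / n) \<le> D * 4 powr t * (\<Sum>i<n. \<bar>a i x\<bar> / n)"
          using arith_geom_mean[of "{..<n}" "\<lambda>i. \<bar>a i x\<bar>"] n D by (intro mult_left_mono) auto
        also have "(\<Sum>i<n. \<bar>a i x\<bar> / n) = inverse (real n) * (\<Sum>i<n. \<bar>a i x\<bar>)"
          by (simp add: sum_divide_distrib[symmetric] field_simps)
        finally show ?thesis using True by (simp add: F_def)
      next
        case False
        then show ?thesis by (simp add: F_def)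
      qed
    qed
    then have "\<rho>0 (F n) \<le> \<rho>0 (\<lambda>x. D * 4 powr t * (inverse (real n) * (\<Sum>i<n. \<bar>a i x\<bar>)))"
      by (intro L0.norm_mono) measurable
    also have "\<dots> = ennreal (D * 4 powr t) * (ennreal (inverse (real n)) * \<rho>0 (\<lambda>x. \<Sum>i<n. \<bar>a i x\<bar>))"
      using D by (simp add: L0.norm_scale abs_mult)
    also have "\<dots> \<le> ennreal (D * 4 powr t) * (ennreal (inverse (real n)) * ennreal (real n))"
    proof (intro mult_left_mono)
      have "\<rho>0 (\<lambda>x. \<Sum>i<n. \<bar>a i x\<bar>) \<le> (\<Sum>i<n. \<rho>0 (\<lambda>x. \<bar>a i x\<bar>))"
        by (rule L0.norm_sum_le) measurable
      also have "\<dots> \<le> (\<Sum>i<n. 1)"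
        using a by (intro sum_mono) (simp add: L0.norm_abs)
      also have "\<dots> = ennreal (real n)" by (simp add: ennreal_of_nat_eq_real_of_nat)
      finally show "\<rho>0 (\<lambda>x. \<Sum>i<n. \<bar>a i x\<bar>) \<le> ennreal (real n)" .
    qed auto
    also have "ennreal (inverse (real n)) * ennreal (real n) = 1"
      using n by (simp add: ennreal_mult[symmetric])
    finally show ?thesis by simp
  qed
  \<comment> \<open>The index is shifted by one because the bound \<open>F_norm\<close>, which takes
    \<open>n\<close>-th roots, requires \<open>n > 0\<close>.\<close>
  have lim: "AE x in M. 0 \<le> F (Suc 0) x \<and> incseq (\<lambda>n. F (Suc n) x) \<and> (\<lambda>n. F (Suc n) x) \<longlonglongrightarrow> \<bar>f x\<bar>"
    using h0(3)
  proof eventually_elim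
    case (elim x)
    have "incseq (\<lambda>n. F (Suc n) x)"
    proof (rule incseq_SucI)
      fix n
      have "2 ^ Suc n * h0 x \<le> 2 ^ Suc (Suc n) * h0 x" using elim by simp
      then show "F (Suc n) x \<le> F (Suc (Suc n)) x" by (auto simp: F_def simp del: power_Suc)
    qed
    moreover obtain k where "B x / h0 x < 2 ^ k" using real_arch_pow[of 2 "B x / h0 x"] by auto
    then have k: "B x \<le> 2 ^ k * h0 x" using elim by (simp add: field_simps)
    have "F (Suc n) x = \<bar>f x\<bar>" if "n \<ge> k" for n
    proof -
      have "2 ^ k * h0 x \<le> 2 ^ Suc n * h0 x"
        using elim that by (intro mult_right_mono power_increasing) auto
      then show ?thesis using k by (auto simp: F_def simp del: power_Suc)
    qed
    then have "(\<lambda>n. F (Suc n) x) \<longlonglongrightarrow> \<bar>f x\<bar>"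
      by (intro tendsto_eventually eventually_sequentiallyI[of k]) auto
    ultimately show ?case by (auto simp: F_def)
  qed
  have F_lat: "F (Suc n) \<in> lat M \<rho>0" for n
    using F_norm[of "Suc n"] by (auto simp: lat_def intro: le_less_trans)
  have "(SUP n. \<rho>0 (F (Suc n))) \<le> ennreal (D * 4 powr t)" by (intro SUP_least F_norm) simp
  then have "(SUP n. \<rho>0 (F (Suc n))) < \<infinity>" by (rule le_less_trans) simp
  then have "(\<lambda>n. \<rho>0 (F (Suc n))) \<longlonglongrightarrow> \<rho>0 (\<lambda>x. \<bar>f x\<bar>)"
    using fatou F_lat lim unfolding fatou_def by (auto dest!: spec[of _ "\<lambda>n. F (Suc n)"])
  then have "\<rho>0 (\<lambda>x. \<bar>f x\<bar>) \<le> ennreal (D * 4 powr t)"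
    by (rule LIMSEQ_le_const2) (use F_norm in auto)
  then show ?thesis by (simp add: L0.norm_abs D_def t_def)
qed

end

section \<open>Positive operators on couples\<close>

locale positive_operator =
  X: lattice_couple M \<rho>0 \<rho>1 + Y: lattice_couple N \<sigma>0 \<sigma>1
  for M :: "'a measure" and \<rho>0 \<rho>1 :: "('a \<Rightarrow> real) \<Rightarrow> ennreal"
    and N :: "'b measure" and \<sigma>0 \<sigma>1 :: "('b \<Rightarrow> real) \<Rightarrow> ennreal" +
  fixes T :: "('a \<Rightarrow> real) \<Rightarrow> ('b \<Rightarrow> real)"
  assumes admissible: "admissible_positive_op M \<rho>0 \<rho>1 N \<sigma>0 \<sigma>1 T"
begin

lemma T_sum_space: "f \<in> X.E \<Longrightarrow> T f \<in> Y.E"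
  and T_cong: "f \<in> X.E \<Longrightarrow> g \<in> X.E \<Longrightarrow> AE x in M. f x = g x \<Longrightarrow> AE y in N. T f y = T g y"
  and T_lincomb: "f \<in> X.E \<Longrightarrow> g \<in> X.E \<Longrightarrow>
    AE y in N. T (\<lambda>x. c * f x + d * g x) y = c * T f y + d * T g y"
  and T_nonneg: "f \<in> X.E \<Longrightarrow> AE x in M. 0 \<le> f x \<Longrightarrow> AE y in N. 0 \<le> T f y"
  and T_bounded0: "\<exists>C. \<forall>f \<in> lat M \<rho>0. \<sigma>0 (T f) \<le> ennreal C * \<rho>0 f"
  using admissible unfolding admissible_positive_op_def by (blast+)

lemma T_measurable: "f \<in> X.E \<Longrightarrow> T f \<in> borel_measurable N"
  by (intro Y.sum_space_measurable T_sum_space)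

lemma T_add: "f \<in> X.E \<Longrightarrow> g \<in> X.E \<Longrightarrow> AE y in N. T (\<lambda>x. f x + g x) y = T f y + T g y"
  using T_lincomb[of f g 1 1] by simp

lemma T_diff: "f \<in> X.E \<Longrightarrow> g \<in> X.E \<Longrightarrow> AE y in N. T (\<lambda>x. f x - g x) y = T f y - T g y"
  using T_lincomb[of f g 1 "-1"] by simp

lemma T_scale: "f \<in> X.E \<Longrightarrow> AE y in N. T (\<lambda>x. c * f x) y = c * T f y"
  using T_lincomb[of f f c 0] by simp

lemma T_mono:
  assumes f: "f \<in> X.E" and g: "g \<in> X.E" and le: "AE x in M. f x \<le> g x"
  shows "AE y in N. T f y \<le> T g y"
proof -
  have "AE y in N. 0 \<le> T (\<lambda>x. g x - f x) y"
    by (rule T_nonneg[OF X.sum_space_diff[OF g f]]) (use le in \<open>auto elim!: eventually_mono\<close>)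
  then show ?thesis using T_diff[OF g f] by eventually_elim auto
qed

lemma T_abs_le:
  assumes f: "f \<in> X.E"
  shows "AE y in N. \<bar>T f y\<bar> \<le> T (\<lambda>x. \<bar>f x\<bar>) y"
proof -
  note af = X.sum_space_abs[OF f]
  have "AE y in N. T f y \<le> T (\<lambda>x. \<bar>f x\<bar>) y" by (rule T_mono[OF f af]) auto
  moreover have "AE y in N. T (\<lambda>x. - 1 * f x) y \<le> T (\<lambda>x. \<bar>f x\<bar>) y"
    by (rule T_mono[OF X.sum_space_scale[OF f] af]) auto
  ultimately show ?thesis using T_scale[OF f, of "-1"] by eventually_elim auto
qed

text \<open>Write \<open>f\<^sup>1\<^sup>-\<^sup>\<theta> g\<^sup>\<theta>\<close> as the infimum of the linear functions
  \<open>(1 - \<theta>) r\<^sup>\<theta> f + \<theta> r\<^sup>\<theta>\<^sup>-\<^sup>1 g\<close> over rational \<open>r > 0\<close>; countability keeps the exceptional set null.\<close>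
lemma T_powr_mult_le:
  assumes f: "f \<in> X.E" and g: "g \<in> X.E" and \<theta>: "0 < \<theta>" "\<theta> < 1"
  shows "AE y in N. T (\<lambda>x. \<bar>f x\<bar> powr (1 - \<theta>) * \<bar>g x\<bar> powr \<theta>) y
    \<le> T (\<lambda>x. \<bar>f x\<bar>) y powr (1 - \<theta>) * T (\<lambda>x. \<bar>g x\<bar>) y powr \<theta>"
proof -
  let ?h = "\<lambda>x. \<bar>f x\<bar> powr (1 - \<theta>) * \<bar>g x\<bar> powr \<theta>"
  note af = X.sum_space_abs[OF f] and ag = X.sum_space_abs[OF g]
  have h: "?h \<in> X.E" by (rule X.sum_space_powr_mult[OF f g \<theta>])
  have "AE y in N. T ?h y \<le> (1 - \<theta>) * r powr \<theta> * T (\<lambda>x. \<bar>f x\<bar>) y + \<theta> * r powr (\<theta> - 1) * T (\<lambda>x. \<bar>g x\<bar>) y"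
    if "0 < r" for r :: real
  proof -
    have "AE y in N. T ?h y \<le> T (\<lambda>x. ((1 - \<theta>) * r powr \<theta>) * \<bar>f x\<bar> + (\<theta> * r powr (\<theta> - 1)) * \<bar>g x\<bar>) y"
      by (rule T_mono[OF h X.sum_space_lincomb[OF af ag]])
        (use powr_mult_le_weighted_sum[OF _ _ that \<theta>] in auto)
    then show ?thesis
      using T_lincomb[OF af ag, of "(1 - \<theta>) * r powr \<theta>" "\<theta> * r powr (\<theta> - 1)"] by eventually_elim auto
  qed
  then have "AE y in N. \<forall>r\<in>\<rat>. 0 < r \<longrightarrow>
      T ?h y \<le> (1 - \<theta>) * r powr \<theta> * T (\<lambda>x. \<bar>f x\<bar>) y + \<theta> * r powr (\<theta> - 1) * T (\<lambda>x. \<bar>g x\<bar>) y"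
    by (subst AE_ball_countable[OF countable_rat]) auto
  moreover have "AE y in N. 0 \<le> T (\<lambda>x. \<bar>f x\<bar>) y" "AE y in N. 0 \<le> T (\<lambda>x. \<bar>g x\<bar>) y"
    by (intro T_nonneg af ag; simp)+
  ultimately show ?thesis
    by eventually_elim (intro le_powr_mult_of_rational_bounds \<theta>; blast)
qed

lemma T_bound0:
  obtains C where "1 \<le> C" "\<And>f. f \<in> lat M \<rho>0 \<Longrightarrow> \<sigma>0 (T f) \<le> ennreal C * \<rho>0 f"
proof -
  obtain C where C: "\<forall>f \<in> lat M \<rho>0. \<sigma>0 (T f) \<le> ennreal C * \<rho>0 f" using T_bounded0 by blast
  show ?thesis
  proof (rule that[of "max 1 C"])
    fix f assume "f \<in> lat M \<rho>0"
    then have "\<sigma>0 (T f) \<le> ennreal C * \<rho>0 f" using C by blast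
    also have "\<dots> \<le> ennreal (max 1 C) * \<rho>0 f" by (intro mult_right_mono ennreal_leI) auto
    finally show "\<sigma>0 (T f) \<le> ennreal (max 1 C) * \<rho>0 f" .
  qed simp
qed

lemma T_lat0:
  assumes "f \<in> lat M \<rho>0"
  shows "T f \<in> lat N \<sigma>0"
proof -
  obtain C where "\<And>f. f \<in> lat M \<rho>0 \<Longrightarrow> \<sigma>0 (T f) \<le> ennreal C * \<rho>0 f" using T_bound0 by blast
  then have "\<sigma>0 (T f) \<le> ennreal C * \<rho>0 f" using assms by blast
  also have "\<dots> < \<infinity>" using X.L0.lat_finite[OF assms] by (simp add: ennreal_mult_less_top)
  finally show ?thesis using T_measurable[OF X.lat0_sum_space[OF assms]] by (simp add: lat_def)
qed

text \<open>The hypotheses on \<open>T\<close> are symmetric in the endpoints, so each statement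
  about endpoint 0 yields its counterpart for endpoint 1.\<close>

lemma swap: "positive_operator M \<rho>1 \<rho>0 N \<sigma>1 \<sigma>0 T"
proof unfold_locales
  show "admissible_positive_op M \<rho>1 \<rho>0 N \<sigma>1 \<sigma>0 T"
    using admissible unfolding admissible_positive_op_def
    by (simp only: sum_space_swap[of M \<rho>1 \<rho>0] sum_space_swap[of N \<sigma>1 \<sigma>0]) blast
qed

lemmas T_bound1 = positive_operator.T_bound0[OF swap]
  and T_lat1 = positive_operator.T_lat0[OF swap]

text \<open>If \<open>a\<close>, \<open>b\<close> factorize a bound of \<open>f\<close>, then
  \<open>T a\<close>, \<open>T b\<close> factorize a bound of \<open>T f\<close> by the Hoelder
  inequality \<open>T_powr_mult_le\<close>.\<close>

lemma T_calderon:
  assumes \<theta>: "0 < \<theta>" "\<theta> < 1" and f: "f \<in> calderon M \<rho>0 \<rho>1 \<theta>"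
  shows "T f \<in> calderon N \<sigma>0 \<sigma>1 \<theta>"
proof -
  obtain a b where ab: "a \<in> lat M \<rho>0" "b \<in> lat M \<rho>1" "\<And>x. 0 \<le> a x" "\<And>x. 0 \<le> b x"
    "AE x in M. \<bar>f x\<bar> \<le> a x powr (1 - \<theta>) * b x powr \<theta>" using f by (rule X.calderonE) blast
  have fE: "f \<in> X.E" using X.calderon_subset_sum_space[OF \<theta>] f by blast
  have aE: "a \<in> X.E" and bE: "b \<in> X.E" using ab X.lat0_sum_space X.lat1_sum_space by auto
  have abs_eq: "(\<lambda>x. \<bar>a x\<bar>) = a" "(\<lambda>x. \<bar>b x\<bar>) = b" using ab by auto
  let ?h = "\<lambda>x. \<bar>a x\<bar> powr (1 - \<theta>) * \<bar>b x\<bar> powr \<theta>"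
  show ?thesis
  proof (rule Y.calderonI)
    have "AE y in N. T (\<lambda>x. \<bar>f x\<bar>) y \<le> T ?h y"
      by (rule T_mono[OF X.sum_space_abs[OF fE] X.sum_space_powr_mult[OF aE bE \<theta>]])
        (use ab in auto)
    moreover have "AE y in N. 0 \<le> T a y" "AE y in N. 0 \<le> T b y"
      by (rule T_nonneg; use aE bE ab in simp)+
    ultimately show "AE y in N. \<bar>T f y\<bar> \<le> \<bar>T a y\<bar> powr (1 - \<theta>) * \<bar>T b y\<bar> powr \<theta>"
      using T_abs_le[OF fE] T_powr_mult_le[OF aE bE \<theta>, unfolded abs_eq]
      by eventually_elim (simp add: ab(3,4))
  qed (use T_lat0 T_lat1 T_measurable fE ab in auto)
qed

end

section \<open>The K-functional and real interpolation spaces\<close>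

lemma Kfun_mono: "s \<le> t \<Longrightarrow> Kfun M \<rho>0 \<rho>1 s f \<le> Kfun M \<rho>0 \<rho>1 t f"
  unfolding Kfun_def by (intro INF_mono') (auto intro!: add_left_mono mult_right_mono ennreal_leI)

text \<open>Monotonicity in \<open>t\<close> makes every superlevel set an interval.\<close>

lemma Kfun_borel_measurable: "(\<lambda>t. Kfun M \<rho>0 \<rho>1 t f) \<in> borel_measurable borel"
proof (rule borel_measurableI_greater)
  fix y
  let ?S = "{t \<in> space borel. y < Kfun M \<rho>0 \<rho>1 t f}"
  have "is_interval ?S"
    unfolding is_interval_1 by (auto intro: less_le_trans[OF _ Kfun_mono])
  then show "?S \<in> sets borel"
    by (rule real_interval_borel_measurable)
qed

lemma epow_mono: "x \<le> y \<Longrightarrow> 0 \<le> q \<Longrightarrow> epow x q \<le> epow y q"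
  by (auto simp: epow_def top_unique less_top intro!: ennreal_leI powr_mono2 enn2real_mono)

lemma epow_mult:
  assumes "0 < c" "0 < q"
  shows "epow (ennreal c * x) q = ennreal (c powr q) * epow x q"
  using assms by (cases x) (auto simp: epow_def ennreal_mult[symmetric] ennreal_mult_eq_top_iff ennreal_mult_top powr_mult)

lemma epow_finite_iff: "epow x q < top \<longleftrightarrow> x < top"
  by (auto simp: epow_def less_top[symmetric])

lemma epow_borel_measurable [measurable (raw)]:
  assumes [measurable]: "f \<in> borel_measurable M"
  shows "(\<lambda>x. epow (f x) q) \<in> borel_measurable M"
  unfolding epow_def by measurable

lemma (in lattice_couple) Kfun_finite_imp_sum_space:
  assumes "f \<in> borel_measurable M" "Kfun M \<rho>0 \<rho>1 t f < \<infinity>" "0 < t"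
  shows "f \<in> E"
proof -
  obtain f0 f1 where "f0 \<in> borel_measurable M" "f1 \<in> borel_measurable M"
    "AE x in M. f x = f0 x + f1 x" "\<rho>0 f0 + ennreal t * \<rho>1 f1 < \<infinity>"
    using assms(2) unfolding Kfun_def Inf_less_iff by auto
  moreover from this have "\<rho>0 f0 < \<infinity>" "\<rho>1 f1 < \<infinity>"
    using \<open>0 < t\<close> by (auto simp: ennreal_mult_less_top)
  ultimately show ?thesis using assms(1) unfolding sum_space_def lat_def by blast
qed

text \<open>If the K-functional were infinite at every \<open>t > 0\<close>, the supremum or the
  integral defining the norm would be infinite. Finiteness at one \<open>t\<close> already provides
  a decomposition.\<close>

lemma (in lattice_couple) real_interp_subset_sum_space:
  assumes "1 \<le> p"
  shows "real_interp M \<rho>0 \<rho>1 \<theta> p \<subseteq> E"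
proof
  fix f assume "f \<in> real_interp M \<rho>0 \<rho>1 \<theta> p"
  then have f: "f \<in> borel_measurable M" "real_interp_norm M \<rho>0 \<rho>1 \<theta> p f < \<infinity>"
    by (auto simp: real_interp_def lat_def)
  have "\<exists>t>0. Kfun M \<rho>0 \<rho>1 t f < \<infinity>"
  proof (rule ccontr)
    assume "\<not> ?thesis"
    then have top: "Kfun M \<rho>0 \<rho>1 t f = \<infinity>" if "0 < t" for t using that by (auto simp: less_top[symmetric])
    show False
    proof (cases "p = \<infinity>")
      case True
      have "ennreal (1 powr (- \<theta>)) * Kfun M \<rho>0 \<rho>1 1 f
          \<le> (SUP t \<in> {0<..}. ennreal (t powr (- \<theta>)) * Kfun M \<rho>0 \<rho>1 t f)"
        by (rule SUP_upper) simp
      also have "\<dots> < \<infinity>" using f(2) True by (simp add: real_interp_norm_def)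
      finally show False using top[of 1] by simp
    next
      case False
      let ?I = "\<integral>\<^sup>+ t \<in> {0<..}. epow (ennreal (t powr (- \<theta>)) * Kfun M \<rho>0 \<rho>1 t f) (enn2real p)
                    * ennreal (1 / t) \<partial>lborel"
      have "?I < \<infinity>" using f(2) False by (simp add: real_interp_norm_def epow_finite_iff)
      moreover have "?I = (\<integral>\<^sup>+ t. \<infinity> * indicator {0<..} t \<partial>(lborel :: real measure))"
        by (intro nn_integral_cong) (auto simp: indicator_def top epow_def ennreal_mult_top ennreal_top_mult)
      moreover have "(\<integral>\<^sup>+ t. \<infinity> * indicator {0<..} t \<partial>(lborel :: real measure)) \<ge> (\<integral>\<^sup>+ t. \<infinity> * indicator {0<..1} t \<partial>(lborel :: real measure))"
        by (intro nn_integral_mono) (auto simp: indicator_def)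
      moreover have "(\<integral>\<^sup>+ t. \<infinity> * indicator {0<..1} t \<partial>(lborel :: real measure)) = \<infinity>"
        by (subst nn_integral_cmult_indicator) auto
      ultimately show False by (simp add: top_unique)
    qed
  qed
  then show "f \<in> E" using Kfun_finite_imp_sum_space f(1) by blast
qed

context positive_operator
begin

text \<open>A decomposition of \<open>f\<close> is mapped to one of \<open>T f\<close>, and
  \<open>C\<close> is the larger of the two endpoint bounds.\<close>

lemma Kfun_T_le:
  obtains C where "1 \<le> C"
    "\<And>t f. 0 < t \<Longrightarrow> f \<in> X.E \<Longrightarrow> Kfun N \<sigma>0 \<sigma>1 t (T f) \<le> ennreal C * Kfun M \<rho>0 \<rho>1 t f"
proof -
  obtain C0 where C0: "1 \<le> C0" "\<And>f. f \<in> lat M \<rho>0 \<Longrightarrow> \<sigma>0 (T f) \<le> ennreal C0 * \<rho>0 f"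
    using T_bound0 by blast
  obtain C1 where C1: "1 \<le> C1" "\<And>f. f \<in> lat M \<rho>1 \<Longrightarrow> \<sigma>1 (T f) \<le> ennreal C1 * \<rho>1 f"
    using T_bound1 by blast
  define C where "C = max C0 C1"
  have C: "1 \<le> C" using C0(1) by (simp add: C_def)
  have "Kfun N \<sigma>0 \<sigma>1 t (T f) \<le> ennreal C * (\<rho>0 f0 + ennreal t * \<rho>1 f1)"
    if t: "0 < t" and f: "f \<in> X.E" and f0: "f0 \<in> borel_measurable M" and f1: "f1 \<in> borel_measurable M"
      and eq: "AE x in M. f x = f0 x + f1 x" for t f f0 f1
  proof (cases "\<rho>0 f0 < \<infinity> \<and> \<rho>1 f1 < \<infinity>")
    case True
    then have lat: "f0 \<in> lat M \<rho>0" "f1 \<in> lat M \<rho>1" using f0 f1 by (auto simp: lat_def)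
    then have E: "f0 \<in> X.E" "f1 \<in> X.E" by (auto intro: X.lat0_sum_space X.lat1_sum_space)
    have "AE y in N. T f y = T f0 y + T f1 y"
      using T_cong[OF f X.sum_space_add[OF E] eq] T_add[OF E] by eventually_elim simp
    then have "Kfun N \<sigma>0 \<sigma>1 t (T f) \<le> \<sigma>0 (T f0) + ennreal t * \<sigma>1 (T f1)"
      unfolding Kfun_def using T_measurable E by (intro INF_lower2[of "(T f0, T f1)"]) auto
    also have "\<dots> \<le> ennreal C0 * \<rho>0 f0 + ennreal t * (ennreal C1 * \<rho>1 f1)"
      using C0(2) C1(2) lat by (intro add_mono mult_left_mono) auto
    also have "\<dots> \<le> ennreal C * \<rho>0 f0 + ennreal t * (ennreal C * \<rho>1 f1)"
      by (intro add_mono mult_left_mono mult_right_mono ennreal_leI) (auto simp: C_def)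
    also have "\<dots> = ennreal C * (\<rho>0 f0 + ennreal t * \<rho>1 f1)"
      by (simp add: distrib_left mult.left_commute)
    finally show ?thesis .
  next
    case False
    \<comment> \<open>\<open>T\<close> is not controlled on such a pair, but its cost is infinite.
      Positivity of \<open>t\<close> matters here, since \<open>0 * \<infinity> = 0\<close> in
      \<open>ennreal\<close>.\<close>
    then have "\<rho>0 f0 + ennreal t * \<rho>1 f1 = \<infinity>"
      using t by (auto simp: less_top[symmetric] ennreal_mult_eq_top_iff)
    then show ?thesis using C by (simp only:) (simp add: ennreal_mult_top)
  qed
  note decomp = this
  \<comment> \<open>The factor \<open>C\<close> is moved to the left of the inequality so that the
    infimum can be handled by \<open>INF_greatest\<close>, and is moved back afterwards.\<close>
  have inv: "ennreal C * (ennreal (inverse C) * x) = x" "ennreal (inverse C) * (ennreal C * x) = x" for x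
    using C by (simp_all add: mult.assoc[symmetric] ennreal_mult[symmetric])
  have "Kfun N \<sigma>0 \<sigma>1 t (T f) \<le> ennreal C * Kfun M \<rho>0 \<rho>1 t f" if "0 < t" "f \<in> X.E" for t f
  proof -
    have "ennreal (inverse C) * Kfun N \<sigma>0 \<sigma>1 t (T f) \<le> Kfun M \<rho>0 \<rho>1 t f"
      unfolding Kfun_def[of M]
    proof (rule INF_greatest)
      fix p assume "p \<in> {(f0, f1). f0 \<in> borel_measurable M \<and> f1 \<in> borel_measurable M \<and>
        (AE x in M. f x = f0 x + f1 x)}"
      then have "Kfun N \<sigma>0 \<sigma>1 t (T f) \<le> ennreal C * (\<rho>0 (fst p) + ennreal t * \<rho>1 (snd p))"
        using that by (auto intro!: decomp)
      then have "ennreal (inverse C) * Kfun N \<sigma>0 \<sigma>1 t (T f)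
          \<le> ennreal (inverse C) * (ennreal C * (\<rho>0 (fst p) + ennreal t * \<rho>1 (snd p)))"
        by (rule mult_left_mono) simp
      then show "ennreal (inverse C) * Kfun N \<sigma>0 \<sigma>1 t (T f) \<le> \<rho>0 (fst p) + ennreal t * \<rho>1 (snd p)"
        by (simp only: inv)
    qed
    then have "ennreal C * (ennreal (inverse C) * Kfun N \<sigma>0 \<sigma>1 t (T f)) \<le> ennreal C * Kfun M \<rho>0 \<rho>1 t f"
      by (rule mult_left_mono) simp
    then show ?thesis by (simp only: inv)
  qed
  then show ?thesis using that C by blast
qed

lemma T_real_interp:
  assumes p: "1 \<le> p" and f: "f \<in> real_interp M \<rho>0 \<rho>1 \<theta> p"
  shows "T f \<in> real_interp N \<sigma>0 \<sigma>1 \<theta> p"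
proof -
  have fE: "f \<in> X.E" using X.real_interp_subset_sum_space[OF p] f by blast
  have fin: "real_interp_norm M \<rho>0 \<rho>1 \<theta> p f < \<infinity>" using f by (simp add: real_interp_def lat_def)
  obtain C where C: "1 \<le> C"
    "\<And>t f. 0 < t \<Longrightarrow> f \<in> X.E \<Longrightarrow> Kfun N \<sigma>0 \<sigma>1 t (T f) \<le> ennreal C * Kfun M \<rho>0 \<rho>1 t f"
    using Kfun_T_le by blast
  have weighted: "ennreal (t powr (- \<theta>)) * Kfun N \<sigma>0 \<sigma>1 t (T f)
      \<le> ennreal C * (ennreal (t powr (- \<theta>)) * Kfun M \<rho>0 \<rho>1 t f)" if "0 < t" for t
    using mult_left_mono[OF C(2)[OF that fE], of "ennreal (t powr (- \<theta>))"]
    by (simp add: mult.left_commute)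
  have "real_interp_norm N \<sigma>0 \<sigma>1 \<theta> p (T f) < \<infinity>"
  proof (cases "p = \<infinity>")
    case True
    have "real_interp_norm N \<sigma>0 \<sigma>1 \<theta> p (T f) \<le> ennreal C * real_interp_norm M \<rho>0 \<rho>1 \<theta> p f"
      using True unfolding real_interp_norm_def
      by (auto intro!: SUP_least order_trans[OF weighted] mult_left_mono SUP_upper)
    also have "\<dots> < \<infinity>" using fin by (simp add: ennreal_mult_less_top)
    finally show ?thesis .
  next
    case False
    define q where "q = enn2real p"
    have q: "0 < q" unfolding q_def using p False
      by (metis enn2real_positive_iff infinity_ennreal_def less_le_trans less_top zero_less_one)
    let ?I = "\<lambda>t. epow (ennreal (t powr (- \<theta>)) * Kfun M \<rho>0 \<rho>1 t f) q * ennreal (1 / t)"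
    have "(\<integral>\<^sup>+ t \<in> {0<..}. epow (ennreal (t powr (- \<theta>)) * Kfun N \<sigma>0 \<sigma>1 t (T f)) q * ennreal (1 / t) \<partial>lborel)
        \<le> (\<integral>\<^sup>+ t. ennreal (C powr q) * (?I t * indicator {0<..} t) \<partial>lborel)"
    proof (rule nn_integral_mono)
      fix t :: real
      show "epow (ennreal (t powr (- \<theta>)) * Kfun N \<sigma>0 \<sigma>1 t (T f)) q * ennreal (1 / t) * indicator {0<..} t
          \<le> ennreal (C powr q) * (?I t * indicator {0<..} t)"
      proof (cases "0 < t")
        case True
        have "epow (ennreal (t powr (- \<theta>)) * Kfun N \<sigma>0 \<sigma>1 t (T f)) q
            \<le> epow (ennreal C * (ennreal (t powr (- \<theta>)) * Kfun M \<rho>0 \<rho>1 t f)) q"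
          using q by (intro epow_mono weighted True) auto
        also have "\<dots> = ennreal (C powr q) * epow (ennreal (t powr (- \<theta>)) * Kfun M \<rho>0 \<rho>1 t f) q"
          using C(1) q by (intro epow_mult) auto
        finally show ?thesis
          using True by (auto simp: mult.assoc[symmetric] intro!: mult_right_mono)
      qed simp
    qed
    also have "\<dots> = ennreal (C powr q) * (\<integral>\<^sup>+ t \<in> {0<..}. ?I t \<partial>lborel)"
    proof (rule nn_integral_cmult)
      note [measurable] = Kfun_borel_measurable[of M \<rho>0 \<rho>1 f]
      show "(\<lambda>t. ?I t * indicator {0<..} t) \<in> borel_measurable lborel" by measurable
    qed
    also have "\<dots> < \<infinity>"
      using fin False by (simp add: real_interp_norm_def epow_finite_iff ennreal_mult_less_top q_def)
    finally show ?thesis using False by (simp add: real_interp_norm_def epow_finite_iff q_def)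
  qed
  then show ?thesis using T_measurable[OF fE] by (simp add: real_interp_def lat_def)
qed

end

section \<open>Lower bounds at the endpoints\<close>

lemma (in lattice_couple) truncation_lat:
  assumes u: "u \<in> lat M \<rho>0" "u \<in> lat M \<rho>1" "\<And>x. 0 \<le> u x" and c: "0 \<le> c"
    and p [measurable]: "p \<in> borel_measurable M" and p_nn: "AE x in M. 0 \<le> p x"
  shows "(\<lambda>x. min (p x) (c * u x)) \<in> lat M \<rho>0" "(\<lambda>x. min (p x) (c * u x)) \<in> lat M \<rho>1"
proof -
  note [measurable] = L0.lat_measurable[OF u(1)]
  have le: "AE x in M. \<bar>min (p x) (c * u x)\<bar> \<le> \<bar>c * u x\<bar>"
    using p_nn by eventually_elim (use u(3) c in \<open>auto simp: min_def abs_mult\<close>)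
  show "(\<lambda>x. min (p x) (c * u x)) \<in> lat M \<rho>0"
    by (rule L0.lat_solid[OF _ L0.lat_scale[OF u(1)] le]) measurable
  show "(\<lambda>x. min (p x) (c * u x)) \<in> lat M \<rho>1"
    by (rule L1.lat_solid[OF _ L1.lat_scale[OF u(2)] le]) measurable
qed

text \<open>The Fatou property serves the lower bounds at the endpoints, order continuity in the
  domain the injectivity on the sum space, and order continuity in the codomain the surjectivity at
  the endpoints.\<close>

locale calderon_isomorphism = positive_operator +
  fixes s :: real
  assumes s: "0 < s" "s < 1"
    and iso: "order_iso M N T (calderon M \<rho>0 \<rho>1 s) (calderon N \<sigma>0 \<sigma>1 s)"
    and fatou_dom: "fatou M \<rho>0" "fatou M \<rho>1"
    and regular_dom: "regular M \<rho>0" "regular M \<rho>1"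
    and regular_cod: "regular N \<sigma>0" "regular N \<sigma>1"
begin

abbreviation A where "A \<equiv> calderon M \<rho>0 \<rho>1 s"
abbreviation B where "B \<equiv> calderon N \<sigma>0 \<sigma>1 s"

lemma iso_surj: "g \<in> B \<Longrightarrow> \<exists>f\<in>A. AE y in N. T f y = g y"
  and iso_nonneg: "f \<in> A \<Longrightarrow> AE y in N. 0 \<le> T f y \<Longrightarrow> AE x in M. 0 \<le> f x"
  using iso unfolding order_iso_def by (blast+)

lemma A_subset: "f \<in> A \<Longrightarrow> f \<in> X.E"
  using X.calderon_subset_sum_space[OF s] by blast

lemma A_mono_reflect:
  assumes p: "p \<in> A" and r: "r \<in> A" and le: "AE y in N. T p y \<le> T r y"
  shows "AE x in M. p x \<le> r x"
proof -
  have "(\<lambda>x. 1 * r x + -1 * p x) \<in> A" by (rule X.calderon_lincomb[OF r p s])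
  moreover have "AE y in N. 0 \<le> T (\<lambda>x. 1 * r x + -1 * p x) y"
    using T_lincomb[OF A_subset[OF r] A_subset[OF p], of 1 "-1"] le by eventually_elim simp
  ultimately have "AE x in M. 0 \<le> 1 * r x + -1 * p x" by (rule iso_nonneg)
  then show ?thesis by eventually_elim simp
qed

text \<open>Order reflection is available only on \<open>A\<close>, which need not contain
  \<open>p\<close>. It is applied to the truncations \<open>min p (k * u)\<close>, which lie in both
  endpoint spaces and hence in \<open>A\<close>; at almost every point one of them equals
  \<open>p\<close>.\<close>

lemma le_of_T_le:
  assumes p: "p \<in> X.E" and p_nn: "AE x in M. 0 \<le> p x" and r: "r \<in> A"
    and le: "AE y in N. T p y \<le> T r y"
  shows "AE x in M. p x \<le> r x"
proof -
  obtain u where u: "u \<in> lat M \<rho>0" "u \<in> lat M \<rho>1" "\<And>x. 0 \<le> u x" "AE x in M. 0 < u x"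
    by (rule X.ex_positive_common) blast
  have "AE x in M. min (p x) (real k * u x) \<le> r x" for k :: nat
  proof (rule A_mono_reflect[OF _ r])
    have lat: "(\<lambda>x. min (p x) (real k * u x)) \<in> lat M \<rho>0" "(\<lambda>x. min (p x) (real k * u x)) \<in> lat M \<rho>1"
      using X.truncation_lat[OF u(1-3) _ X.sum_space_measurable[OF p] p_nn, of "real k"] by auto
    then show "(\<lambda>x. min (p x) (real k * u x)) \<in> A" by (rule X.lat_Int_calderon)
    have "AE y in N. T (\<lambda>x. min (p x) (real k * u x)) y \<le> T p y"
      by (rule T_mono[OF X.lat0_sum_space[OF lat(1)] p]) auto
    then show "AE y in N. T (\<lambda>x. min (p x) (real k * u x)) y \<le> T r y"
      using le by eventually_elim auto
  qed
  then have "AE x in M. \<forall>k::nat. min (p x) (real k * u x) \<le> r x" by (simp add: AE_all_countable)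
  then show ?thesis using u(4)
  proof eventually_elim
    case (elim x)
    obtain k :: nat where "p x / u x < real k" using reals_Archimedean2 by blast
    then have "p x \<le> real k * u x" using elim(2) by (simp add: field_simps)
    then show ?case using elim(1)[rule_format, of k] by simp
  qed
qed

text \<open>A quantitative form of the boundedness of the positive inverse of \<open>T\<close> on the Calderon
  product. If it failed with constants \<open>4\<^sup>n\<close>, then the sums of the series of the counterexamples,
  weighted by \<open>2\<^sup>-\<^sup>n\<close>, would dominate all of them at once.\<close>
lemma uniform_factorization:
  obtains C where "0 < C"
    "\<And>p a b. p \<in> X.E \<Longrightarrow> AE x in M. 0 \<le> p x \<Longrightarrow> a \<in> borel_measurable N \<Longrightarrow> b \<in> borel_measurable N \<Longrightarrow>
      \<sigma>0 a \<le> 1 \<Longrightarrow> \<sigma>1 b \<le> 1 \<Longrightarrow> AE y in N. T p y \<le> \<bar>a y\<bar> powr (1 - s) * \<bar>b y\<bar> powr s \<Longrightarrow>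
      \<exists>f0\<in>borel_measurable M. \<exists>f1\<in>borel_measurable M. \<rho>0 f0 \<le> 1 \<and> \<rho>1 f1 \<le> 1 \<and>
        (AE x in M. p x \<le> C * (\<bar>f0 x\<bar> powr (1 - s) * \<bar>f1 x\<bar> powr s))"
proof -
  define H where "H p a b \<longleftrightarrow> p \<in> X.E \<and> (AE x in M. 0 \<le> p x) \<and> a \<in> borel_measurable N \<and> b \<in> borel_measurable N \<and>
      \<sigma>0 a \<le> 1 \<and> \<sigma>1 b \<le> 1 \<and> (AE y in N. T p y \<le> \<bar>a y\<bar> powr (1 - s) * \<bar>b y\<bar> powr s)" for p a b
  define R where "R C p \<longleftrightarrow> (\<exists>f0\<in>borel_measurable M. \<exists>f1\<in>borel_measurable M. \<rho>0 f0 \<le> 1 \<and> \<rho>1 f1 \<le> 1 \<and>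
        (AE x in M. p x \<le> C * (\<bar>f0 x\<bar> powr (1 - s) * \<bar>f1 x\<bar> powr s)))" for C p
  have "\<exists>C>0. \<forall>p a b. H p a b \<longrightarrow> R C p"
  proof (rule ccontr)
    assume "\<not> ?thesis"
    then have "\<forall>n::nat. \<exists>p a b. H p a b \<and> \<not> R (4 ^ n) p"
      by (meson zero_less_numeral zero_less_power)
    then obtain p a b where H: "\<And>n::nat. H (p n) (a n) (b n)" and R: "\<And>n. \<not> R (4 ^ n) (p n)"
      by metis
    have p: "\<And>n. p n \<in> X.E" "\<And>n. AE x in M. 0 \<le> p n x"
      and a: "\<And>n. a n \<in> borel_measurable N" "\<And>n. \<sigma>0 (a n) \<le> 1"
      and b: "\<And>n. b n \<in> borel_measurable N" "\<And>n. \<sigma>1 (b n) \<le> 1"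
      and Tp: "\<And>n. AE y in N. T (p n) y \<le> \<bar>a n y\<bar> powr (1 - s) * \<bar>b n y\<bar> powr s"
      using H unfolding H_def by blast+
    obtain a' where a': "a' \<in> lat N \<sigma>0" "\<And>y. 0 \<le> a' y" "\<And>n. AE y in N. \<bar>a n y\<bar> \<le> 2 ^ n * a' y"
      by (rule Y.L0.ex_common_bound[of a, OF a]) blast
    obtain b' where b': "b' \<in> lat N \<sigma>1" "\<And>y. 0 \<le> b' y" "\<And>n. AE y in N. \<bar>b n y\<bar> \<le> 2 ^ n * b' y"
      by (rule Y.L1.ex_common_bound[of b, OF b]) blast
    \<comment> \<open>Since \<open>T (p n) \<le> 2 ^ n * ?q\<close> for all \<open>n\<close>, one
      preimage \<open>r\<close> of \<open>?q\<close> dominates every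
      \<open>inverse (2 ^ n) * p n\<close>.\<close>
    let ?q = "\<lambda>y. \<bar>a' y\<bar> powr (1 - s) * \<bar>b' y\<bar> powr s"
    have "?q \<in> B"
      by (rule Y.calderonI[OF _ a'(1) b'(1)])
        (use Y.L0.lat_measurable[OF a'(1)] Y.L1.lat_measurable[OF b'(1)] in \<open>auto simp: abs_mult\<close>)
    then obtain r where r: "r \<in> A" "AE y in N. T r y = ?q y" using iso_surj by blast
    obtain f0 f1 where f: "f0 \<in> lat M \<rho>0" "f1 \<in> lat M \<rho>1" "\<And>x. 0 \<le> f0 x" "\<And>x. 0 \<le> f1 x"
      "AE x in M. \<bar>r x\<bar> \<le> f0 x powr (1 - s) * f1 x powr s" using r(1) by (rule X.calderonE) blast
    \<comment> \<open>For this \<open>n\<close>, normalizing \<open>f0\<close> and \<open>f1\<close>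
      costs a factor \<open>2 ^ n\<close>, and passing from \<open>r\<close> to \<open>p n\<close>
      costs another. Together they give \<open>4 ^ n\<close>, which contradicts the choice of
      \<open>p n\<close>.\<close>
    obtain n where n: "max (enn2real (\<rho>0 f0)) (enn2real (\<rho>1 f1)) < 2 ^ n"
      using real_arch_pow[of 2] by fastforce
    have "AE x in M. inverse (2 ^ n) * p n x \<le> r x"
    proof (rule le_of_T_le[OF X.sum_space_scale[OF p(1)] _ r(1)])
      show "AE x in M. 0 \<le> inverse (2 ^ n) * p n x" using p(2)[of n] by eventually_elim simp
      show "AE y in N. T (\<lambda>x. inverse (2 ^ n) * p n x) y \<le> T r y"
        using T_scale[OF p(1)[of n], of "inverse (2 ^ n)"] Tp[of n] r(2) a'(3)[of n] b'(3)[of n]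
      proof eventually_elim
        case (elim y)
        have "T (p n) y \<le> (2 ^ n * a' y) powr (1 - s) * (2 ^ n * b' y) powr s"
          using elim s by (intro order_trans[OF elim(2)] powr_mult_mono) auto
        also have "\<dots> = 2 ^ n * ?q y" using a'(2) b'(2) by (subst powr_mult_scale) auto
        finally have "inverse (2 ^ n) * T (p n) y \<le> ?q y" by (simp add: field_simps)
        then show ?case using elim(1,3) by simp
      qed
    qed
    then have "AE x in M. p n x \<le> 4 ^ n * (\<bar>inverse (2 ^ n) * f0 x\<bar> powr (1 - s) * \<bar>inverse (2 ^ n) * f1 x\<bar> powr s)"
      using f(5)
    proof eventually_elim
      case (elim x)
      have "p n x = 2 ^ n * (inverse (2 ^ n) * p n x)" by simp
      also have "\<dots> \<le> 2 ^ n * (f0 x powr (1 - s) * f1 x powr s)"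
        using elim by (intro mult_left_mono) auto
      also have "\<dots> = 4 ^ n * (inverse (2 ^ n) * (f0 x powr (1 - s) * f1 x powr s))"
        by (simp add: field_simps power_mult_distrib[symmetric])
      also have "inverse (2 ^ n) * (f0 x powr (1 - s) * f1 x powr s)
          = (inverse (2 ^ n) * f0 x) powr (1 - s) * (inverse (2 ^ n) * f1 x) powr s"
        using f(3,4) by (subst powr_mult_scale) auto
      finally show ?case using f(3,4)[of x] by (simp add: abs_mult)
    qed
    moreover have "\<rho>0 (\<lambda>x. inverse (2 ^ n) * f0 x) \<le> 1" "\<rho>1 (\<lambda>x. inverse (2 ^ n) * f1 x) \<le> 1"
      using n by (auto intro!: X.L0.norm_normalize X.L1.norm_normalize f)
    moreover have "(\<lambda>x. inverse (2 ^ n) * f0 x) \<in> borel_measurable M" "(\<lambda>x. inverse (2 ^ n) * f1 x) \<in> borel_measurable M"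
      using X.L0.lat_measurable[OF f(1)] X.L1.lat_measurable[OF f(2)] by auto
    ultimately have "R (4 ^ n) (p n)" unfolding R_def by blast
    with R show False by blast
  qed
  then show ?thesis using that unfolding H_def R_def by blast
qed

text \<open>The Hoelder inequality places the image of the product of powers of \<open>f\<close> and
  \<open>h\<close> below a product with first factor \<open>T f\<close>. Then
  \<open>uniform_factorization\<close> supplies exactly the hypothesis of
  \<open>norm_bound_of_factorization\<close>.\<close>

lemma norm0_bound_unit:
  obtains K where "0 < K"
    "\<And>f. f \<in> X.E \<Longrightarrow> AE x in M. 0 \<le> f x \<Longrightarrow> \<sigma>0 (T f) \<le> 1 \<Longrightarrow> \<rho>0 f \<le> ennreal K"
proof -
  obtain C where C: "0 < C"
    "\<And>p a b. p \<in> X.E \<Longrightarrow> AE x in M. 0 \<le> p x \<Longrightarrow> a \<in> borel_measurable N \<Longrightarrow> b \<in> borel_measurable N \<Longrightarrow>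
      \<sigma>0 a \<le> 1 \<Longrightarrow> \<sigma>1 b \<le> 1 \<Longrightarrow> AE y in N. T p y \<le> \<bar>a y\<bar> powr (1 - s) * \<bar>b y\<bar> powr s \<Longrightarrow>
      \<exists>f0\<in>borel_measurable M. \<exists>f1\<in>borel_measurable M. \<rho>0 f0 \<le> 1 \<and> \<rho>1 f1 \<le> 1 \<and>
        (AE x in M. p x \<le> C * (\<bar>f0 x\<bar> powr (1 - s) * \<bar>f1 x\<bar> powr s))"
    by (rule uniform_factorization) blast
  obtain D where D: "1 \<le> D" "\<And>f. f \<in> lat M \<rho>1 \<Longrightarrow> \<sigma>1 (T f) \<le> ennreal D * \<rho>1 f"
    using T_bound1 by blast
  have CD: "0 < D * C" using C(1) D(1) by simp
  show ?thesis
  proof (rule that[of "(D * C) powr (1 / (1 - s)) * 4 powr (s / (1 - s))"])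
    fix f assume f: "f \<in> X.E" and f_nn: "AE x in M. 0 \<le> f x" and Tf: "\<sigma>0 (T f) \<le> 1"
    show "\<rho>0 f \<le> ennreal ((D * C) powr (1 / (1 - s)) * 4 powr (s / (1 - s)))"
    proof (rule X.norm_bound_of_factorization[OF fatou_dom(1) X.sum_space_measurable[OF f] CD s])
      fix h assume h: "h \<in> borel_measurable M" "\<rho>1 h \<le> 1"
      have h_lat: "h \<in> lat M \<rho>1" using h by (auto simp: lat_def intro: le_less_trans)
      note hE = X.lat1_sum_space[OF h_lat]
      let ?g = "\<lambda>x. \<bar>f x\<bar> powr (1 - s) * \<bar>h x\<bar> powr s"
      have g: "?g \<in> X.E" by (rule X.sum_space_powr_mult[OF f hE s])
      \<comment> \<open>Division by the operator bound \<open>D\<close> puts the image of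
        \<open>\<bar>h\<bar>\<close> into the unit ball.\<close>
      let ?b = "\<lambda>y. inverse D * T (\<lambda>x. \<bar>h x\<bar>) y"
      note ah = X.sum_space_abs[OF hE]
      have "\<exists>f0\<in>borel_measurable M. \<exists>f1\<in>borel_measurable M. \<rho>0 f0 \<le> 1 \<and> \<rho>1 f1 \<le> 1 \<and>
        (AE x in M. inverse D * ?g x \<le> C * (\<bar>f0 x\<bar> powr (1 - s) * \<bar>f1 x\<bar> powr s))"
      proof (rule C(2))
        show "(\<lambda>x. inverse D * ?g x) \<in> X.E" by (rule X.sum_space_scale[OF g])
        show "AE x in M. 0 \<le> inverse D * ?g x" using D(1) by simp
        show "T f \<in> borel_measurable N" by (rule T_measurable[OF f])
        show "?b \<in> borel_measurable N" using T_measurable[OF ah] by measurable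
        show "\<sigma>0 (T f) \<le> 1" by fact
        have "\<sigma>1 ?b = ennreal (inverse D) * \<sigma>1 (T (\<lambda>x. \<bar>h x\<bar>))"
          using D(1) by (subst Y.L1.norm_scale[OF T_measurable[OF ah]]) auto
        also have "\<dots> \<le> ennreal (inverse D) * (ennreal D * 1)"
          using h(2)
          by (intro mult_left_mono order_trans[OF D(2)[OF X.L1.lat_abs[OF h_lat]]])
            (auto simp: X.L1.norm_abs[OF h(1)])
        also have "\<dots> = 1" using D(1) by (simp add: ennreal_mult[symmetric])
        finally show "\<sigma>1 ?b \<le> 1" .
        have absf: "AE y in N. T (\<lambda>x. \<bar>f x\<bar>) y = T f y"
          by (rule T_cong[OF X.sum_space_abs[OF f] f]) (use f_nn in auto)
        have "AE y in N. 0 \<le> T f y" by (rule T_nonneg[OF f f_nn])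
        moreover have "AE y in N. 0 \<le> T (\<lambda>x. \<bar>h x\<bar>) y" by (rule T_nonneg[OF ah]) auto
        ultimately show "AE y in N. T (\<lambda>x. inverse D * ?g x) y \<le> \<bar>T f y\<bar> powr (1 - s) * \<bar>?b y\<bar> powr s"
          using T_scale[OF g, of "inverse D"] T_powr_mult_le[OF f hE s] absf
        proof eventually_elim
          case (elim y)
          \<comment> \<open>As \<open>D \<ge> 1\<close>, dividing the whole product by
            \<open>D\<close> gives at most what dividing only its second base by \<open>D\<close>
            gives.\<close>
          have "inverse D powr 1 \<le> inverse D powr s"
            using D(1) s by (intro powr_mono') (auto simp: field_simps)
          then have "inverse D \<le> inverse D powr s" using D(1) by simp
          then have "inverse D * (T f y powr (1 - s) * T (\<lambda>x. \<bar>h x\<bar>) y powr s)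
              \<le> inverse D powr s * (T f y powr (1 - s) * T (\<lambda>x. \<bar>h x\<bar>) y powr s)"
            by (intro mult_right_mono) auto
          also have "\<dots> = \<bar>T f y\<bar> powr (1 - s) * \<bar>?b y\<bar> powr s"
            using elim(1,2) D(1) by (simp add: powr_mult abs_mult)
          moreover have "T (\<lambda>x. inverse D * ?g x) y \<le> inverse D * (T f y powr (1 - s) * T (\<lambda>x. \<bar>h x\<bar>) y powr s)"
            using elim(3,4,5) D(1) by (simp add: mult_left_mono)
          ultimately show ?case by linarith
        qed
      qed
      then obtain f0 f1 where f01: "f0 \<in> borel_measurable M" "f1 \<in> borel_measurable M" "\<rho>0 f0 \<le> 1" "\<rho>1 f1 \<le> 1"
        and le: "AE x in M. inverse D * ?g x \<le> C * (\<bar>f0 x\<bar> powr (1 - s) * \<bar>f1 x\<bar> powr s)" by blast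
      have "AE x in M. ?g x \<le> D * C * (\<bar>f0 x\<bar> powr (1 - s) * \<bar>f1 x\<bar> powr s)"
        using le
      proof eventually_elim
        case (elim x)
        have "D * (inverse D * ?g x) \<le> D * (C * (\<bar>f0 x\<bar> powr (1 - s) * \<bar>f1 x\<bar> powr s))"
          using elim D(1) by (intro mult_left_mono) auto
        then show ?case using D(1) by (simp add: mult.assoc[symmetric])
      qed
      then show "\<exists>a\<in>borel_measurable M. \<exists>b\<in>borel_measurable M. \<rho>0 a \<le> 1 \<and> \<rho>1 b \<le> 1 \<and>
        (AE x in M. ?g x \<le> D * C * (\<bar>a x\<bar> powr (1 - s) * \<bar>b x\<bar> powr s))"
        using f01 by blast
    qed
  qed (use C(1) D(1) in \<open>auto intro!: mult_pos_pos\<close>)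
qed

lemma norm0_bound:
  obtains K where "0 < K"
    "\<And>f. f \<in> X.E \<Longrightarrow> AE x in M. 0 \<le> f x \<Longrightarrow> T f \<in> lat N \<sigma>0 \<Longrightarrow> \<rho>0 f \<le> ennreal K * \<sigma>0 (T f)"
proof -
  obtain K where K: "0 < K"
    "\<And>f. f \<in> X.E \<Longrightarrow> AE x in M. 0 \<le> f x \<Longrightarrow> \<sigma>0 (T f) \<le> 1 \<Longrightarrow> \<rho>0 f \<le> ennreal K"
    by (rule norm0_bound_unit) blast
  show ?thesis
  proof (rule that[OF K(1)])
    fix f assume f: "f \<in> X.E" "AE x in M. 0 \<le> f x" "T f \<in> lat N \<sigma>0"
    define k where "k = enn2real (\<sigma>0 (T f))"
    have k: "\<sigma>0 (T f) = ennreal k" "0 \<le> k"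
      using Y.L0.lat_finite[OF f(3)] by (auto simp: k_def)
    note [measurable] = X.sum_space_measurable[OF f(1)]
    \<comment> \<open>A strict majorant \<open>m\<close> of the norm keeps the scaling legitimate
      when \<open>k = 0\<close>; afterwards \<open>m\<close> tends to \<open>k\<close>.\<close>
    have bound: "\<rho>0 f \<le> ennreal (K * m)" if m: "k < m" for m
    proof -
      have m0: "0 < m" using k(2) m by simp
      have "\<rho>0 (\<lambda>x. inverse m * f x) \<le> ennreal K"
      proof (rule K(2)[OF X.sum_space_scale[OF f(1)]])
        show "AE x in M. 0 \<le> inverse m * f x" using f(2) m0 by (auto elim!: eventually_mono)
        have "\<sigma>0 (T (\<lambda>x. inverse m * f x)) = \<sigma>0 (\<lambda>y. inverse m * T f y)"
          by (rule Y.L0.norm_cong[OF T_measurable _ T_scale[OF f(1)]])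
            (use X.sum_space_scale[OF f(1)] T_measurable[OF f(1)] in auto)
        also have "\<dots> \<le> 1"
          by (rule Y.L0.norm_normalize[OF f(3)]) (use m m0 k_def in auto)
        finally show "\<sigma>0 (T (\<lambda>x. inverse m * f x)) \<le> 1" .
      qed
      then have "ennreal (inverse m) * \<rho>0 f \<le> ennreal K"
        using m0 by (simp add: X.L0.norm_scale)
      then have "ennreal m * (ennreal (inverse m) * \<rho>0 f) \<le> ennreal m * ennreal K"
        by (rule mult_left_mono) simp
      then show ?thesis
        using m0 K(1) by (simp add: mult.assoc[symmetric] ennreal_mult[symmetric] mult.commute[of m])
    qed
    have "\<rho>0 f \<le> ennreal (K * k)"
    proof (rule ennreal_le_epsilon)
      fix e :: real assume e: "0 < e"
      have "\<rho>0 f \<le> ennreal (K * (k + e / K))" by (rule bound) (use e K(1) in simp)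
      also have "K * (k + e / K) = K * k + e" using K(1) by (simp add: distrib_left)
      finally show "\<rho>0 f \<le> ennreal (K * k) + ennreal e" using K(1) k(2) e by simp
    qed
    then show "\<rho>0 f \<le> ennreal K * \<sigma>0 (T f)"
      using K(1) k by (simp add: ennreal_mult)
  qed
qed

end

section \<open>The inverse operator\<close>

context positive_operator
begin

text \<open>The excess of \<open>q\<close> over \<open>k * u\<close> decreases to zero, hence in
  norm by order continuity, and so do its images by boundedness. The images decrease, so convergence
  in norm forces convergence almost everywhere of the whole sequence.\<close>

lemma T_excess_tendsto_0:
  assumes reg: "regular M \<rho>0" and q: "q \<in> lat M \<rho>0" "\<And>x. 0 \<le> q x"
    and u: "u \<in> lat M \<rho>0" "\<And>x. 0 \<le> u x" "AE x in M. 0 < u x"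
  shows "AE y in N. (\<lambda>k::nat. T (\<lambda>x. max 0 (q x - real k * u x)) y) \<longlonglongrightarrow> 0"
proof -
  define e where "e k = (\<lambda>x. max 0 (q x - real k * u x))" for k :: nat
  note [measurable] = X.L0.lat_measurable[OF q(1)] X.L0.lat_measurable[OF u(1)]
  have e_lat: "e k \<in> lat M \<rho>0" for k
  proof (rule X.L0.lat_solid[OF _ q(1)])
    show "e k \<in> borel_measurable M" unfolding e_def by measurable
    show "AE x in M. \<bar>e k x\<bar> \<le> \<bar>q x\<bar>" using q(2) u(2) by (auto simp: e_def)
  qed
  note eE = X.lat0_sum_space[OF e_lat]
  have e_dec: "e (Suc k) x \<le> e k x" for k x
  proof -
    have "real k * u x \<le> real (Suc k) * u x" using u(2) by (intro mult_right_mono) auto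
    then show ?thesis unfolding e_def by auto
  qed
  have "AE x in M. (\<forall>n. 0 \<le> e n x) \<and> decseq (\<lambda>n. e n x) \<and> (\<lambda>n. e n x) \<longlonglongrightarrow> 0"
    using u(3)
  proof eventually_elim
    case (elim x)
    obtain k :: nat where k: "q x / u x < real k" using reals_Archimedean2 by blast
    have "e n x = 0" if "n \<ge> k" for n
    proof -
      have "q x / u x \<le> real n" using k that by linarith
      then show ?thesis using elim by (simp add: e_def field_simps)
    qed
    then have "(\<lambda>n. e n x) \<longlonglongrightarrow> 0"
      by (intro tendsto_eventually eventually_sequentiallyI[of k]) auto
    moreover have "decseq (\<lambda>n. e n x)" using e_dec by (rule decseq_SucI)
    ultimately show ?case by (auto simp: e_def)
  qed
  then have lim: "(\<lambda>n. \<rho>0 (e n)) \<longlonglongrightarrow> 0" using reg e_lat unfolding regular_def by blast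
  obtain C where C: "\<And>f. f \<in> lat M \<rho>0 \<Longrightarrow> \<sigma>0 (T f) \<le> ennreal C * \<rho>0 f" using T_bound0 by blast
  have limC: "(\<lambda>n. ennreal C * \<rho>0 (e n)) \<longlonglongrightarrow> 0"
    using ennreal_tendsto_cmult[OF _ lim, of "ennreal C"] by simp
  note [measurable] = T_measurable[OF eE]
  have bdd: "bdd_below (range (\<lambda>k. \<bar>T (e k) y\<bar>))" for y by (rule bdd_belowI[of _ 0]) auto
  \<comment> \<open>The images are nonnegative only almost everywhere; absolute values make the
    infimum well defined at every point.\<close>
  define d where "d y = (INF k. \<bar>T (e k) y\<bar>)" for y
  have d: "d \<in> borel_measurable N" unfolding d_def by measurable
  have "AE y in N. d y = 0"
  proof (rule Y.L0.norm_le_limit_zero[OF d _ limC])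
    fix n
    have "0 \<le> d y" "d y \<le> \<bar>T (e n) y\<bar>" for y
      unfolding d_def using bdd[of y] by (auto intro: cINF_greatest cINF_lower)
    then have "\<sigma>0 d \<le> \<sigma>0 (T (e n))"
      by (intro Y.L0.norm_mono[OF d]) auto
    also have "\<dots> \<le> ennreal C * \<rho>0 (e n)" by (rule C[OF e_lat])
    finally show "\<sigma>0 d \<le> ennreal C * \<rho>0 (e n)" .
  qed
  moreover have "AE y in N. \<forall>k. 0 \<le> T (e k) y"
    unfolding AE_all_countable by (intro allI T_nonneg[OF eE]) (simp add: e_def)
  moreover have "AE y in N. \<forall>k. T (e (Suc k)) y \<le> T (e k) y"
    unfolding AE_all_countable by (intro allI T_mono[OF eE eE]) (simp add: e_dec)
  ultimately have "AE y in N. (\<lambda>k. T (e k) y) \<longlonglongrightarrow> 0"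
  proof eventually_elim
    case (elim y)
    have "decseq (\<lambda>k. \<bar>T (e k) y\<bar>)" using elim(2,3) by (intro decseq_SucI) auto
    then have "(\<lambda>k. \<bar>T (e k) y\<bar>) \<longlonglongrightarrow> d y" unfolding d_def by (rule LIMSEQ_decseq_INF[OF bdd])
    then show ?case using elim(1,2) by simp
  qed
  then show ?thesis by (simp add: e_def)
qed

lemmas T_excess_tendsto_0' = positive_operator.T_excess_tendsto_0[OF swap]

end

section \<open>Order reflection and injectivity on the sum space\<close>

context calderon_isomorphism
begin

lemma T_zero: "r \<in> X.E \<Longrightarrow> AE x in M. r x = 0 \<Longrightarrow> AE y in N. T r y = 0"
  using T_cong[of r "\<lambda>x. 0 * r x"] T_scale[of r 0] X.sum_space_scale[of r 0] by auto

text \<open>By solidity the minimum of the images lies in \<open>B\<close>, so it is the image of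
  some \<open>r\<close> in \<open>A\<close>. Order reflection puts \<open>r\<close> between zero and
  both \<open>p\<close> and \<open>q\<close>, hence \<open>r = 0\<close>.\<close>

lemma T_disjoint:
  assumes p: "p \<in> A" "AE x in M. 0 \<le> p x" and q: "q \<in> A" "AE x in M. 0 \<le> q x"
    and disj: "AE x in M. min (p x) (q x) = 0"
  shows "AE y in N. min (T p y) (T q y) = 0"
proof -
  note pE = A_subset[OF p(1)] and qE = A_subset[OF q(1)]
  note [measurable] = T_measurable[OF pE] T_measurable[OF qE]
  have nn: "AE y in N. 0 \<le> T p y" "AE y in N. 0 \<le> T q y"
    using T_nonneg[OF pE p(2)] T_nonneg[OF qE q(2)] by auto
  have "(\<lambda>y. min (T p y) (T q y)) \<in> B"
  proof (rule Y.calderon_solid[OF _ T_calderon[OF s p(1)]])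
    show "AE y in N. \<bar>min (T p y) (T q y)\<bar> \<le> \<bar>T p y\<bar>" using nn by eventually_elim auto
  qed measurable
  then obtain r where r: "r \<in> A" "AE y in N. T r y = min (T p y) (T q y)" using iso_surj by blast
  have "AE x in M. r x \<le> p x" by (rule A_mono_reflect[OF r(1) p(1)]) (use r(2) in auto)
  moreover have "AE x in M. r x \<le> q x" by (rule A_mono_reflect[OF r(1) q(1)]) (use r(2) in auto)
  moreover have "AE x in M. 0 \<le> r x"
    by (rule iso_nonneg[OF r(1)]) (use r(2) nn in \<open>eventually_elim, auto\<close>)
  ultimately have "AE x in M. r x = 0" using disj by eventually_elim (auto simp: min_def split: if_splits)
  then have "AE y in N. T r y = 0" by (rule T_zero[OF A_subset[OF r(1)]])
  then show ?thesis using r(2) by eventually_elim simp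
qed

text \<open>Let \<open>p\<close> be the negative part of \<open>f\<close> cut at \<open>u\<close>.
  Its image lies below the image of the positive part \<open>q\<close>, but is disjoint from the
  images of all truncations of \<open>q\<close>. The images of the remaining excesses tend to zero,
  so \<open>T p \<le> 0\<close> and \<open>p = 0\<close>; since \<open>u > 0\<close>, the negative
  part vanishes.\<close>

lemma T_reflects_nonneg:
  assumes f: "f \<in> X.E" and Tf: "AE y in N. 0 \<le> T f y"
  shows "AE x in M. 0 \<le> f x"
proof -
  note [measurable] = X.sum_space_measurable[OF f]
  obtain u where u: "u \<in> lat M \<rho>0" "u \<in> lat M \<rho>1" "\<And>x. 0 \<le> u x" "AE x in M. 0 < u x"
    by (rule X.ex_positive_common) blast
  note [measurable] = X.L0.lat_measurable[OF u(1)]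
  define p0 where "p0 = (\<lambda>x. max 0 (- f x))"
  define q where "q = (\<lambda>x. max 0 (f x))"
  have p0: "p0 \<in> X.E" by (rule X.sum_space_solid[OF _ f]) (auto simp: p0_def)
  have q: "q \<in> X.E" by (rule X.sum_space_solid[OF _ f]) (auto simp: q_def)
  have nn: "0 \<le> p0 x" "0 \<le> q x" "min (p0 x) (q x) = 0" for x by (auto simp: p0_def q_def)
  have "AE y in N. T f y = T q y - T p0 y"
    using T_diff[OF q p0] T_cong[OF f X.sum_space_diff[OF q p0]]
    by (auto simp: p0_def q_def)
  with Tf have Tp0: "AE y in N. T p0 y \<le> T q y" by eventually_elim simp
  obtain q0 q1 where q01: "q0 \<in> lat M \<rho>0" "q1 \<in> lat M \<rho>1" "\<And>x. 0 \<le> q0 x" "\<And>x. 0 \<le> q1 x"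
    "AE x in M. \<bar>q x\<bar> \<le> q0 x + q1 x" using q by (rule X.sum_spaceE) blast
  note [measurable] = X.L0.lat_measurable[OF q01(1)] X.L1.lat_measurable[OF q01(2)]
  define p where "p = (\<lambda>x. min (p0 x) (1 * u x))"
  have trunc: "(\<lambda>x. min (g x) (c * u x)) \<in> A" if "g \<in> X.E" "\<And>x. 0 \<le> g x" "0 \<le> c" for g c
    using X.truncation_lat[OF u(1-3) that(3) X.sum_space_measurable[OF that(1)]] that(2)
    by (intro X.lat_Int_calderon) auto
  have pA: "p \<in> A" unfolding p_def by (rule trunc[OF p0 nn(1)]) simp
  \<comment> \<open>The factor 2 arises because \<open>q\<close> is dominated by
    \<open>q0 + q1\<close> and each summand is cut at \<open>k * u\<close>.\<close>
  define qk where "qk k = (\<lambda>x. min (q x) ((2 * real k) * u x))" for k :: nat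
  have qkA: "qk k \<in> A" for k unfolding qk_def by (rule trunc[OF q nn(2)]) simp
  define e0 where "e0 k = (\<lambda>x. max 0 (q0 x - real k * u x))" for k :: nat
  define e1 where "e1 k = (\<lambda>x. max 0 (q1 x - real k * u x))" for k :: nat
  have p_nn: "0 \<le> p x" and qk_nn: "0 \<le> qk k x" for k x
    using nn u(3)[of x] by (auto simp: p_def qk_def)
  have disj: "AE y in N. min (T p y) (T (qk k) y) = 0" for k
  proof (rule T_disjoint[OF pA _ qkA])
    have "min (p x) (qk k x) = 0" for x
      using nn(3)[of x] p_nn[of x] qk_nn[of k x] by (auto simp: p_def qk_def min_def split: if_splits)
    then show "AE x in M. min (p x) (qk k x) = 0" by simp
  qed (use p_nn qk_nn in auto)
  have e0E: "e0 k \<in> X.E" for k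
    by (rule X.sum_space_solid[OF _ X.lat0_sum_space[OF q01(1)]])
      (use q01(3) u(3) in \<open>auto simp: e0_def\<close>)
  have e1E: "e1 k \<in> X.E" for k
    by (rule X.sum_space_solid[OF _ X.lat1_sum_space[OF q01(2)]])
      (use q01(4) u(3) in \<open>auto simp: e1_def\<close>)
  have Tq: "AE y in N. T q y \<le> T (qk k) y + (T (e0 k) y + T (e1 k) y)" for k
  proof -
    note qkE = A_subset[OF qkA[of k]]
    note eE = X.sum_space_add[OF e0E[of k] e1E[of k]]
    have "AE y in N. T q y \<le> T (\<lambda>x. qk k x + (e0 k x + e1 k x)) y"
    proof (rule T_mono[OF q X.sum_space_add[OF qkE eE]])
      show "AE x in M. q x \<le> qk k x + (e0 k x + e1 k x)"
        using q01(5) by eventually_elim (auto simp: qk_def e0_def e1_def min_def max_def)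
    qed
    then show ?thesis using T_add[OF qkE eE] T_add[OF e0E[of k] e1E[of k]] by eventually_elim simp
  qed
  have Tp: "AE y in N. T p y \<le> T p0 y"
    by (rule T_mono[OF A_subset[OF pA] p0]) (simp add: p_def)
  have "AE y in N. \<forall>k. min (T p y) (T (qk k) y) = 0" "AE y in N. \<forall>k. T q y \<le> T (qk k) y + (T (e0 k) y + T (e1 k) y)"
    using disj Tq by (simp_all add: AE_all_countable)
  moreover have "AE y in N. (\<lambda>k. T (e0 k) y) \<longlonglongrightarrow> 0"
    unfolding e0_def by (rule T_excess_tendsto_0[OF regular_dom(1) q01(1,3) u(1,3,4)])
  moreover have "AE y in N. (\<lambda>k. T (e1 k) y) \<longlonglongrightarrow> 0"
    unfolding e1_def by (rule T_excess_tendsto_0'[OF regular_dom(2) q01(2,4) u(2,3,4)])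
  ultimately have "AE y in N. T p y \<le> 0"
    using Tp Tp0
  proof eventually_elim
    case (elim y)
    show ?case
    proof (rule ccontr)
      assume "\<not> T p y \<le> 0"
      \<comment> \<open>Where \<open>T p y > 0\<close>, disjointness kills every truncation of
        \<open>q\<close>, so \<open>T p y\<close> is bounded by the excess terms alone.\<close>
      then have "T (qk k) y = 0" for k using elim(1)[rule_format, of k] by (auto simp: min_def split: if_splits)
      then have "T p y \<le> T (e0 k) y + T (e1 k) y" for k
        using elim(2)[rule_format, of k] elim(5,6) by simp
      moreover have "(\<lambda>k. T (e0 k) y + T (e1 k) y) \<longlonglongrightarrow> 0 + 0"
        by (intro tendsto_add elim(3,4))
      ultimately have "T p y \<le> 0 + 0" by (intro LIMSEQ_le_const) auto
      with \<open>\<not> T p y \<le> 0\<close> show False by simp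
    qed
  qed
  then have "AE y in N. 0 \<le> T (\<lambda>x. -1 * p x + 0 * p x) y"
    using T_lincomb[OF A_subset[OF pA] A_subset[OF pA], of "-1" 0] by eventually_elim simp
  then have "AE x in M. 0 \<le> -1 * p x + 0 * p x"
    by (rule iso_nonneg[OF X.calderon_lincomb[OF pA pA s]])
  then show ?thesis using u(4)
  proof eventually_elim
    case (elim x)
    then show ?case using p_nn[of x] by (auto simp: p_def p0_def min_def max_def split: if_splits)
  qed
qed

lemma T_injective:
  assumes f: "f \<in> X.E" and g: "g \<in> X.E" and eq: "AE y in N. T f y = T g y"
  shows "AE x in M. f x = g x"
proof -
  have "AE x in M. 0 \<le> f x - g x"
    by (rule T_reflects_nonneg[OF X.sum_space_diff[OF f g]])
      (use eq T_diff[OF f g] in \<open>eventually_elim, simp\<close>)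
  moreover have "AE x in M. 0 \<le> g x - f x"
    by (rule T_reflects_nonneg[OF X.sum_space_diff[OF g f]])
      (use eq T_diff[OF g f] in \<open>eventually_elim, simp\<close>)
  ultimately show ?thesis by eventually_elim simp
qed

section \<open>Surjectivity on the endpoint spaces\<close>

text \<open>The truncations \<open>gn n\<close> lie in both endpoint spaces, hence in
  \<open>B\<close>, and have preimages in \<open>A\<close>. They converge to \<open>g\<close> by
  order continuity, and the lower bound \<open>norm0_bound\<close> makes the preimages a Cauchy
  sequence.\<close>

lemma lat0_surj_nonneg:
  assumes g: "g \<in> lat N \<sigma>0" and g_nn: "AE y in N. 0 \<le> g y"
  shows "\<exists>f\<in>lat M \<rho>0. AE y in N. T f y = g y"
proof -
  obtain v where v: "v \<in> lat N \<sigma>0" "v \<in> lat N \<sigma>1" "\<And>x. 0 \<le> v x" "AE x in N. 0 < v x"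
    by (rule Y.ex_positive_common) blast
  note [measurable] = Y.L0.lat_measurable[OF g] Y.L0.lat_measurable[OF v(1)]
  define gn where "gn n = (\<lambda>y. min (g y) (real n * v y))" for n :: nat
  have gn_lat: "gn n \<in> lat N \<sigma>0" "gn n \<in> lat N \<sigma>1" for n
    unfolding gn_def by (intro Y.truncation_lat[OF v(1-3) _ _ g_nn]; simp)+
  note [measurable] = Y.L0.lat_measurable[OF gn_lat(1)]
  have "gn n \<in> B" for n by (rule Y.lat_Int_calderon[OF gn_lat])
  then have "\<forall>n. \<exists>f\<in>A. AE y in N. T f y = gn n y" using iso_surj by blast
  then obtain f where f: "\<And>n. f n \<in> A" "\<And>n. AE y in N. T (f n) y = gn n y" by metis
  note fE = A_subset[OF f(1)]
  note [measurable] = X.sum_space_measurable[OF fE]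
  have gn_mono: "gn m y \<le> gn n y" if "m \<le> n" for m n y
  proof -
    have "real m * v y \<le> real n * v y" using that v(3) by (intro mult_right_mono) auto
    then show ?thesis by (auto simp: gn_def)
  qed
  have gn_nn: "AE y in N. 0 \<le> gn n y" for n
    using g_nn by eventually_elim (use v(3) in \<open>auto simp: gn_def\<close>)
  define d where "d n = (\<lambda>y. g y - gn n y)" for n
  have d_lat: "d n \<in> lat N \<sigma>0" for n unfolding d_def by (rule Y.L0.lat_diff[OF g gn_lat(1)])
  have "AE y in N. (\<forall>n. 0 \<le> d n y) \<and> decseq (\<lambda>n. d n y) \<and> (\<lambda>n. d n y) \<longlonglongrightarrow> 0"
    using v(4)
  proof eventually_elim
    case (elim y)
    obtain k :: nat where k: "g y / v y < real k" using reals_Archimedean2 by blast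
    have "d n y = 0" if "n \<ge> k" for n
    proof -
      have "g y / v y \<le> real n" using k that by linarith
      then show ?thesis using elim by (simp add: d_def gn_def field_simps)
    qed
    then have "(\<lambda>n. d n y) \<longlonglongrightarrow> 0"
      by (intro tendsto_eventually eventually_sequentiallyI[of k]) auto
    moreover have "decseq (\<lambda>n. d n y)"
      using gn_mono by (intro decseq_SucI) (simp add: d_def)
    ultimately show ?case by (auto simp: d_def gn_def)
  qed
  then have d_lim: "(\<lambda>n. \<sigma>0 (d n)) \<longlonglongrightarrow> 0"
    using regular_cod(1) d_lat unfolding regular_def by blast
  obtain K where K: "0 < K"
    "\<And>f. f \<in> X.E \<Longrightarrow> AE x in M. 0 \<le> f x \<Longrightarrow> T f \<in> lat N \<sigma>0 \<Longrightarrow> \<rho>0 f \<le> ennreal K * \<sigma>0 (T f)"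
    by (rule norm0_bound) blast
  have f_nn: "AE x in M. 0 \<le> f n x" for n
    by (rule iso_nonneg[OF f(1)]) (use f(2)[of n] gn_nn[of n] in \<open>eventually_elim, simp\<close>)
  have f_lat: "f n \<in> lat M \<rho>0" for n
  proof -
    have Tf: "T (f n) \<in> lat N \<sigma>0"
      by (rule Y.L0.lat_AE_cong[OF gn_lat(1) T_measurable[OF fE] f(2)])
    have "\<rho>0 (f n) \<le> ennreal K * \<sigma>0 (T (f n))" by (rule K(2)[OF fE f_nn Tf])
    also have "\<dots> < \<infinity>" using Y.L0.lat_finite[OF Tf] by (simp add: ennreal_mult_less_top)
    finally show ?thesis by (simp add: lat_def)
  qed
  have cauchy0: "\<rho>0 (\<lambda>x. f m x - f n x) \<le> ennreal K * \<sigma>0 (d k)" if "k \<le> n" "n \<le> m" for k m n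
  proof -
    note dE = X.sum_space_diff[OF fE[of m] fE[of n]]
    have T: "AE y in N. T (\<lambda>x. f m x - f n x) y = gn m y - gn n y"
      using T_diff[OF fE[of m] fE[of n]] f(2)[of m] f(2)[of n] by eventually_elim simp
    \<comment> \<open>The lower bound holds for nonnegative functions, so order reflection on the
      sum space is needed before it applies to differences.\<close>
    have nn: "AE x in M. 0 \<le> f m x - f n x"
      by (rule T_reflects_nonneg[OF dE]) (use T in eventually_elim, use gn_mono[OF that(2)] in simp)
    have lat: "T (\<lambda>x. f m x - f n x) \<in> lat N \<sigma>0"
      by (rule Y.L0.lat_AE_cong[OF Y.L0.lat_diff[OF gn_lat(1)[of m] gn_lat(1)[of n]] T_measurable[OF dE] T])
    have "\<rho>0 (\<lambda>x. f m x - f n x) \<le> ennreal K * \<sigma>0 (T (\<lambda>x. f m x - f n x))" by (rule K(2)[OF dE nn lat])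
    also have "\<dots> \<le> ennreal K * \<sigma>0 (d k)"
    proof (intro mult_left_mono Y.L0.norm_mono)
      show "AE y in N. \<bar>T (\<lambda>x. f m x - f n x) y\<bar> \<le> \<bar>d k y\<bar>"
        using T
      proof eventually_elim
        case (elim y)
        have "gn m y \<le> g y" by (simp add: gn_def)
        then show ?case using elim gn_mono[OF that(1), of y] gn_mono[OF that(2), of y] by (simp add: d_def)
      qed
    qed (use T_measurable[OF dE] Y.L0.lat_measurable[OF d_lat] in auto)
    finally show ?thesis .
  qed
  have cauchy: "\<rho>0 (\<lambda>x. f m x - f n x) \<le> ennreal K * \<sigma>0 (d k)" if "k \<le> n" "k \<le> m" for k m n
  proof (cases "n \<le> m")
    case False
    have "\<rho>0 (\<lambda>x. f m x - f n x) = \<rho>0 (\<lambda>x. f n x - f m x)"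
      by (intro antisym X.L0.norm_mono) auto
    then show ?thesis using cauchy0 that False by simp
  qed (use cauchy0 that in blast)
  have Kd: "(\<lambda>n. ennreal K * \<sigma>0 (d n)) \<longlonglongrightarrow> 0"
    using ennreal_tendsto_cmult[OF _ d_lim, of "ennreal K"] by simp
  have "\<exists>f' \<in> lat M \<rho>0. (\<lambda>n. \<rho>0 (\<lambda>x. f n x - f' x)) \<longlonglongrightarrow> 0"
  proof (rule X.L0.complete)
    show "\<forall>e>0. \<exists>N. \<forall>m\<ge>N. \<forall>n\<ge>N. \<rho>0 (\<lambda>x. f m x - f n x) < ennreal e"
    proof (intro allI impI)
      fix e :: real assume "0 < e"
      then have "\<forall>\<^sub>F n in sequentially. ennreal K * \<sigma>0 (d n) < ennreal e"
        using order_tendstoD(2)[OF Kd, of "ennreal e"] by simp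
      then obtain k where "ennreal K * \<sigma>0 (d k) < ennreal e"
        by (auto simp: eventually_sequentially)
      then show "\<exists>N. \<forall>m\<ge>N. \<forall>n\<ge>N. \<rho>0 (\<lambda>x. f m x - f n x) < ennreal e"
        using cauchy by (meson le_less_trans)
    qed
  qed (use f_lat in blast)
  then obtain f' where f': "f' \<in> lat M \<rho>0" "(\<lambda>n. \<rho>0 (\<lambda>x. f n x - f' x)) \<longlonglongrightarrow> 0" by blast
  note f'E = X.lat0_sum_space[OF f'(1)]
  note [measurable] = T_measurable[OF f'E] Y.L0.lat_measurable[OF d_lat]
  obtain C where C: "\<And>f. f \<in> lat M \<rho>0 \<Longrightarrow> \<sigma>0 (T f) \<le> ennreal C * \<rho>0 f" using T_bound0 by blast
  \<comment> \<open>Up to sign the difference is \<open>T (f n - f') + d n\<close>, and the norms of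
    both terms tend to zero.\<close>
  have "AE y in N. T f' y - g y = 0"
  proof (rule Y.L0.norm_le_limit_zero)
    show "\<sigma>0 (\<lambda>y. T f' y - g y) \<le> ennreal C * \<rho>0 (\<lambda>x. f n x - f' x) + \<sigma>0 (d n)" for n
    proof -
      note dE = X.sum_space_diff[OF fE[of n] f'E]
      note [measurable] = T_measurable[OF dE]
      have "\<sigma>0 (\<lambda>y. T f' y - g y) \<le> \<sigma>0 (\<lambda>y. T (\<lambda>x. f n x - f' x) y + d n y)"
      proof (rule Y.L0.norm_mono)
        show "AE y in N. \<bar>T f' y - g y\<bar> \<le> \<bar>T (\<lambda>x. f n x - f' x) y + d n y\<bar>"
          using T_diff[OF fE[of n] f'E] f(2)[of n] by eventually_elim (simp add: d_def)
      qed auto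
      also have "\<dots> \<le> \<sigma>0 (T (\<lambda>x. f n x - f' x)) + \<sigma>0 (d n)"
        by (rule Y.L0.norm_add) measurable
      also have "\<dots> \<le> ennreal C * \<rho>0 (\<lambda>x. f n x - f' x) + \<sigma>0 (d n)"
        by (intro add_right_mono C X.L0.lat_diff f_lat f'(1))
      finally show ?thesis .
    qed
    have "(\<lambda>n. ennreal C * \<rho>0 (\<lambda>x. f n x - f' x) + \<sigma>0 (d n)) \<longlonglongrightarrow> ennreal C * 0 + 0"
      by (intro tendsto_add ennreal_tendsto_cmult f'(2) d_lim) simp
    then show "(\<lambda>n. ennreal C * \<rho>0 (\<lambda>x. f n x - f' x) + \<sigma>0 (d n)) \<longlonglongrightarrow> 0" by simp
  qed measurable
  then show ?thesis using f'(1) by auto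
qed

text \<open>The positive and negative parts of \<open>g\<close> are lifted separately, which doubles
  the constant.\<close>

lemma lat0_surj:
  obtains K where "\<And>g. g \<in> lat N \<sigma>0 \<Longrightarrow>
    \<exists>f\<in>lat M \<rho>0. (AE y in N. T f y = g y) \<and> \<rho>0 f \<le> ennreal K * \<sigma>0 g"
proof -
  obtain K where K: "0 < K"
    "\<And>f. f \<in> X.E \<Longrightarrow> AE x in M. 0 \<le> f x \<Longrightarrow> T f \<in> lat N \<sigma>0 \<Longrightarrow> \<rho>0 f \<le> ennreal K * \<sigma>0 (T f)"
    by (rule norm0_bound) blast
  have part: "\<exists>f\<in>lat M \<rho>0. (AE y in N. T f y = h y) \<and> \<rho>0 f \<le> ennreal K * \<sigma>0 g"
    if g: "g \<in> lat N \<sigma>0" and h: "h \<in> borel_measurable N" "\<And>y. 0 \<le> h y" "\<And>y. h y \<le> \<bar>g y\<bar>" for g h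
  proof -
    have h_lat: "h \<in> lat N \<sigma>0" by (rule Y.L0.lat_solid[OF h(1) g]) (use h in auto)
    obtain f where f: "f \<in> lat M \<rho>0" "AE y in N. T f y = h y"
      using lat0_surj_nonneg[OF h_lat] h(2) by auto
    note fE = X.lat0_sum_space[OF f(1)]
    have "AE x in M. 0 \<le> f x"
      by (rule T_reflects_nonneg[OF fE]) (use f(2) in eventually_elim, use h(2) in simp)
    then have "\<rho>0 f \<le> ennreal K * \<sigma>0 (T f)" by (rule K(2)[OF fE _ T_lat0[OF f(1)]])
    also have "\<dots> \<le> ennreal K * \<sigma>0 g"
    proof (intro mult_left_mono Y.L0.norm_mono)
      show "AE y in N. \<bar>T f y\<bar> \<le> \<bar>g y\<bar>" using f(2) by eventually_elim (use h(2,3) in simp)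
    qed (use T_measurable[OF fE] Y.L0.lat_measurable[OF g] in auto)
    finally show ?thesis using f by blast
  qed
  show ?thesis
  proof (rule that[of "2 * K"])
    fix g assume g: "g \<in> lat N \<sigma>0"
    note [measurable] = Y.L0.lat_measurable[OF g]
    obtain f1 where f1: "f1 \<in> lat M \<rho>0" "AE y in N. T f1 y = max 0 (g y)" "\<rho>0 f1 \<le> ennreal K * \<sigma>0 g"
    proof -
      have "\<exists>f\<in>lat M \<rho>0. (AE y in N. T f y = max 0 (g y)) \<and> \<rho>0 f \<le> ennreal K * \<sigma>0 g"
        by (rule part[OF g]) auto
      then show ?thesis using that by blast
    qed
    obtain f2 where f2: "f2 \<in> lat M \<rho>0" "AE y in N. T f2 y = max 0 (- g y)" "\<rho>0 f2 \<le> ennreal K * \<sigma>0 g"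
    proof -
      have "\<exists>f\<in>lat M \<rho>0. (AE y in N. T f y = max 0 (- g y)) \<and> \<rho>0 f \<le> ennreal K * \<sigma>0 g"
        by (rule part[OF g]) auto
      then show ?thesis using that by blast
    qed
    note [measurable] = X.L0.lat_measurable[OF f1(1)] X.L0.lat_measurable[OF f2(1)]
    have "AE y in N. T (\<lambda>x. f1 x - f2 x) y = g y"
      using T_diff[OF X.lat0_sum_space[OF f1(1)] X.lat0_sum_space[OF f2(1)]] f1(2) f2(2)
      by eventually_elim (auto simp: max_def)
    moreover have "\<rho>0 (\<lambda>x. f1 x - f2 x) \<le> ennreal (2 * K) * \<sigma>0 g"
    proof -
      have "\<rho>0 (\<lambda>x. f1 x + -1 * f2 x) \<le> \<rho>0 f1 + \<rho>0 (\<lambda>x. -1 * f2 x)"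
        by (rule X.L0.norm_add) measurable
      also have "\<rho>0 (\<lambda>x. -1 * f2 x) = \<rho>0 f2" by (subst X.L0.norm_scale) auto
      also have "\<rho>0 f1 + \<rho>0 f2 \<le> ennreal K * \<sigma>0 g + ennreal K * \<sigma>0 g"
        by (intro add_mono f1(3) f2(3))
      also have "\<dots> = ennreal (2 * K) * \<sigma>0 g"
        using K(1) by (simp add: distrib_right[symmetric] ennreal_plus[symmetric] del: ennreal_plus)
      finally show ?thesis by simp
    qed
    ultimately show "\<exists>f\<in>lat M \<rho>0. (AE y in N. T f y = g y) \<and> \<rho>0 f \<le> ennreal (2 * K) * \<sigma>0 g"
      using X.L0.lat_diff[OF f1(1) f2(1)] by blast
  qed
qed

lemma swap_iso: "calderon_isomorphism M \<rho>1 \<rho>0 N \<sigma>1 \<sigma>0 T (1 - s)"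
proof (intro calderon_isomorphism.intro calderon_isomorphism_axioms.intro swap)
  show "order_iso M N T (calderon M \<rho>1 \<rho>0 (1 - s)) (calderon N \<sigma>1 \<sigma>0 (1 - s))"
    using iso by (simp only: calderon_swap)
qed (use s fatou_dom regular_dom regular_cod in auto)

lemmas lat1_surj = calderon_isomorphism.lat0_surj[OF swap_iso]

section \<open>The inverse as a positive operator of the couples\<close>

text \<open>The inverse is chosen pointwise on representatives and is determined only up to null
  sets. Only \<open>T\<close> and the sum space enter, so exchanging the endpoints gives the same
  \<open>S\<close>; \<open>S_bounded1\<close> relies on this.\<close>

definition S :: "('b \<Rightarrow> real) \<Rightarrow> ('a \<Rightarrow> real)" where
  "S g = (SOME f. f \<in> X.E \<and> (AE y in N. T f y = g y))"

lemma S_props: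
  assumes g: "g \<in> Y.E"
  shows S_sum_space: "S g \<in> X.E" and T_S: "AE y in N. T (S g) y = g y"
proof -
  obtain g0 g1 where g01: "g0 \<in> lat N \<sigma>0" "g1 \<in> lat N \<sigma>1" "AE y in N. g y = g0 y + g1 y"
    using g by (auto simp: sum_space_def)
  obtain f0 where f0: "f0 \<in> lat M \<rho>0" "AE y in N. T f0 y = g0 y" using lat0_surj g01(1) by metis
  obtain f1 where f1: "f1 \<in> lat M \<rho>1" "AE y in N. T f1 y = g1 y" using lat1_surj g01(2) by metis
  note E = X.lat0_sum_space[OF f0(1)] X.lat1_sum_space[OF f1(1)]
  have "AE y in N. T (\<lambda>x. f0 x + f1 x) y = g y"
    using T_add[OF E] f0(2) f1(2) g01(3) by eventually_elim simp
  then have "\<exists>f. f \<in> X.E \<and> (AE y in N. T f y = g y)" using X.sum_space_add[OF E] by blast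
  then have "S g \<in> X.E \<and> (AE y in N. T (S g) y = g y)" unfolding S_def by (rule someI_ex)
  then show "S g \<in> X.E" "AE y in N. T (S g) y = g y" by auto
qed

lemma S_eq:
  assumes "f \<in> X.E" "g \<in> Y.E" "AE y in N. T f y = g y"
  shows "AE x in M. S g x = f x"
  by (rule T_injective[OF S_sum_space[OF assms(2)] assms(1)])
    (use T_S[OF assms(2)] assms(3) in \<open>eventually_elim, simp\<close>)

lemma S_bounded0: "\<exists>C. \<forall>g \<in> lat N \<sigma>0. \<rho>0 (S g) \<le> ennreal C * \<sigma>0 g"
proof -
  obtain K where K: "\<And>g. g \<in> lat N \<sigma>0 \<Longrightarrow>
    \<exists>f\<in>lat M \<rho>0. (AE y in N. T f y = g y) \<and> \<rho>0 f \<le> ennreal K * \<sigma>0 g" by (rule lat0_surj) blast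
  have "\<rho>0 (S g) \<le> ennreal K * \<sigma>0 g" if g: "g \<in> lat N \<sigma>0" for g
  proof -
    obtain f where f: "f \<in> lat M \<rho>0" "AE y in N. T f y = g y" "\<rho>0 f \<le> ennreal K * \<sigma>0 g"
      using K[OF g] by blast
    note gE = Y.lat0_sum_space[OF g]
    have "\<rho>0 (S g) = \<rho>0 f"
      by (rule X.L0.norm_cong[OF X.sum_space_measurable[OF S_sum_space[OF gE]] X.L0.lat_measurable[OF f(1)]
          S_eq[OF X.lat0_sum_space[OF f(1)] gE f(2)]])
    then show ?thesis using f(3) by simp
  qed
  then show ?thesis by blast
qed

lemma S_bounded1: "\<exists>C. \<forall>g \<in> lat N \<sigma>1. \<rho>1 (S g) \<le> ennreal C * \<sigma>1 g"
proof -
  have "calderon_isomorphism.S M \<rho>1 \<rho>0 N T = S"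
    by (simp add: fun_eq_iff S_def calderon_isomorphism.S_def[OF swap_iso] sum_space_swap[of M \<rho>1 \<rho>0])
  then show ?thesis using calderon_isomorphism.S_bounded0[OF swap_iso] by simp
qed

lemma positive_operator_S: "positive_operator N \<sigma>0 \<sigma>1 M \<rho>0 \<rho>1 S"
proof unfold_locales
  show "admissible_positive_op N \<sigma>0 \<sigma>1 M \<rho>0 \<rho>1 S"
    unfolding admissible_positive_op_def
  proof (intro conjI ballI allI impI S_bounded0 S_bounded1 S_sum_space)
    fix f g assume f: "f \<in> Y.E" and g: "g \<in> Y.E" and eq: "AE y in N. f y = g y"
    show "AE x in M. S f x = S g x"
      by (rule S_eq[OF S_sum_space[OF g] f]) (use T_S[OF g] eq in \<open>eventually_elim, simp\<close>)
  next
    fix f g a b assume f: "f \<in> Y.E" and g: "g \<in> Y.E"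
    show "AE x in M. S (\<lambda>y. a * f y + b * g y) x = a * S f x + b * S g x"
      by (rule S_eq[OF X.sum_space_lincomb[OF S_sum_space[OF f] S_sum_space[OF g]] Y.sum_space_lincomb[OF f g]])
        (use T_S[OF f] T_S[OF g] T_lincomb[OF S_sum_space[OF f] S_sum_space[OF g], of a b]
          in \<open>eventually_elim, simp\<close>)
  next
    fix f assume f: "f \<in> Y.E" and nn: "AE y in N. 0 \<le> f y"
    show "AE x in M. 0 \<le> S f x"
      by (rule T_reflects_nonneg[OF S_sum_space[OF f]]) (use T_S[OF f] nn in \<open>eventually_elim, simp\<close>)
  qed
qed

text \<open>Injectivity and order reflection hold on the whole sum space, so for subspaces only
  invariance under \<open>T\<close> and \<open>S\<close> remains to be checked.\<close>

lemma order_iso_of_invariant: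
  assumes "F \<subseteq> X.E" "G \<subseteq> Y.E" "\<And>f. f \<in> F \<Longrightarrow> T f \<in> G" "\<And>g. g \<in> G \<Longrightarrow> S g \<in> F"
  shows "order_iso M N T F G"
  unfolding order_iso_def
proof (intro conjI ballI allI impI)
  show "\<exists>f\<in>F. AE y in N. T f y = g y" if "g \<in> G" for g
    using that assms T_S[of g] by (intro bexI[of _ "S g"]) auto
qed (use assms T_lincomb T_injective T_nonneg T_reflects_nonneg in \<open>auto simp: subset_eq\<close>)

end

theorem theorem5p2:
  fixes M :: "'a measure" and N :: "'b measure"
    and \<rho>0 \<rho>1 :: "('a \<Rightarrow> real) \<Rightarrow> ennreal"
    and \<sigma>0 \<sigma>1 :: "('b \<Rightarrow> real) \<Rightarrow> ennreal"
    and T :: "('a \<Rightarrow> real) \<Rightarrow> ('b \<Rightarrow> real)"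
    and \<theta>s :: real
  assumes "banach_lattice M \<rho>0" "regular M \<rho>0" "fatou M \<rho>0"
    and "banach_lattice M \<rho>1" "regular M \<rho>1" "fatou M \<rho>1"
    and "banach_lattice N \<sigma>0" "regular N \<sigma>0" "fatou N \<sigma>0"
    and "banach_lattice N \<sigma>1" "regular N \<sigma>1" "fatou N \<sigma>1"
    and "admissible_positive_op M \<rho>0 \<rho>1 N \<sigma>0 \<sigma>1 T"
    and "0 < \<theta>s" "\<theta>s < 1"
    and "order_iso M N T (calderon M \<rho>0 \<rho>1 \<theta>s) (calderon N \<sigma>0 \<sigma>1 \<theta>s)"
  shows "\<forall>\<theta>. 0 < \<theta> \<and> \<theta> < 1 \<longrightarrow>
           order_iso M N T (calderon M \<rho>0 \<rho>1 \<theta>) (calderon N \<sigma>0 \<sigma>1 \<theta>) \<and>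
           (\<forall>p::ennreal. 1 \<le> p \<longrightarrow>
              order_iso M N T (real_interp M \<rho>0 \<rho>1 \<theta> p) (real_interp N \<sigma>0 \<sigma>1 \<theta> p))"
proof -
  interpret calderon_isomorphism M \<rho>0 \<rho>1 N \<sigma>0 \<sigma>1 T \<theta>s
    by unfold_locales (use assms in auto)
  \<comment> \<open>With \<open>S\<close> as a second positive operator, the interpolation lemmas
    for \<open>T\<close> also give the invariance under the inverse.\<close>
  interpret inv: positive_operator N \<sigma>0 \<sigma>1 M \<rho>0 \<rho>1 S
    by (rule positive_operator_S)
  show ?thesis
  proof (intro allI impI conjI)
    fix \<theta> :: real assume \<theta>: "0 < \<theta> \<and> \<theta> < 1"
    show "order_iso M N T (calderon M \<rho>0 \<rho>1 \<theta>) (calderon N \<sigma>0 \<sigma>1 \<theta>)"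
      using \<theta> by (intro order_iso_of_invariant X.calderon_subset_sum_space
          Y.calderon_subset_sum_space T_calderon inv.T_calderon) auto
    show "order_iso M N T (real_interp M \<rho>0 \<rho>1 \<theta> p) (real_interp N \<sigma>0 \<sigma>1 \<theta> p)"
      if "1 \<le> p" for p :: ennreal
      using that by (intro order_iso_of_invariant X.real_interp_subset_sum_space
          Y.real_interp_subset_sum_space T_real_interp inv.T_real_interp) auto
  qed
qed

end
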